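(* Let $\boldsymbol{f}_{i,S}$, $i=1,\dots,d$, be entropy conservative fluxes (symmetric, consistent, and satisfying $(\boldsymbol v_L-\boldsymbol v_R)^T\boldsymbol f_{i,S}(\boldsymbol u_L,\boldsymbol u_R)=\psi_i(\boldsymbol u_L)-\psi_i(\boldsymbol u_R)$), and assume that $\boldsymbol Q^j_k\boldsymbol 1=0$ for $j=1,\dots,d$ on each element $D^k$. Let the coefficient vectors $\boldsymbol u_h(t)$ (one per element) solve the semi-discrete scheme: on each element $D^k$, $$\frac{d\boldsymbol u_h}{dt}+(\boldsymbol M^k)^{-1}\begin{bmatrix}\boldsymbol V_q^T\boldsymbol W & \boldsymbol V_f^T\boldsymbol W_f\end{bmatrix}\sum_{j=1}^d\left(2\boldsymbol D^j_k\circ\boldsymbol F_{j,S}\right)\boldsymbol 1+\sum_{j=1}^d\boldsymbol L^k_q\,\mathrm{diag}(\boldsymbol n_j)\left(\boldsymbol f_j^*-\boldsymbol f_j(\tilde{\boldsymbol u}_f)\right)=0,$$ where $(\boldsymbol F_{j,S})_{mn}=\boldsymbol f_{j,S}(\tilde{\boldsymbol u}_m,\tilde{\boldsymbol u}_n)$ for $1\le m,n\le N_q+N_q^f$, $\boldsymbol f_j^*=\boldsymbol f_{j,S}(\tilde{\boldsymbol u}_f^+,\tilde{\boldsymbol u}_f)$ on interior faces, and on faces in $\partial\Omega$ $\boldsymbol f_j^*$ is the $j$th component of some numerical flux through which boundary conditions are imposed. Here $\boldsymbol u_q=\boldsymbol V_q\boldsymbol u_h$, $\boldsymbol v_h=\boldsymbol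 P^k_q\boldsymbol v(\boldsymbol u_q)$, $\tilde{\boldsymbol v}=\begin{bmatrix}\tilde{\boldsymbol v}_q\\ \tilde{\boldsymbol v}_f\end{bmatrix}=\begin{bmatrix}\boldsymbol V_q\\ \boldsymbol V_f\end{bmatrix}\boldsymbol v_h$, and $\tilde{\boldsymbol u}=\begin{bmatrix}\tilde{\boldsymbol u}_q\\ \tilde{\boldsymbol u}_f\end{bmatrix}=\boldsymbol u(\tilde{\boldsymbol v})$. Then the scheme is entropy conservative in the sense that $$\sum_k\boldsymbol 1^T\mathrm{diag}(\boldsymbol J^k)\boldsymbol W\frac{dU(\boldsymbol u_q)}{dt}=\sum_k\sum_{j=1}^d\boldsymbol 1^T\mathrm{diag}(\boldsymbol n_j\circ\boldsymbol J^k_f)\boldsymbol W_{\partial\Omega}\left(\psi_j(\tilde{\boldsymbol u}_f)-\tilde{\boldsymbol v}_f^T\boldsymbol f_j^*\right).$$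
   Context: Conservation law: $\partial_t\boldsymbol u+\sum_{j=1}^d\partial_{x_j}\boldsymbol f_j(\boldsymbol u)=0$ with $\boldsymbol u(\boldsymbol x,t)\in\mathbb R^n$ and $\boldsymbol f_j:\mathbb R^n\to\mathbb R^n$. There is a convex entropy $U(\boldsymbol u)$ with entropy variables $\boldsymbol v(\boldsymbol u)=\partial U/\partial\boldsymbol u$ (an invertible change of variables with inverse $\boldsymbol u(\boldsymbol v)$), entropy fluxes $F_j$ with $\boldsymbol v^T\partial\boldsymbol f_j/\partial\boldsymbol u=(\partial F_j/\partial\boldsymbol u)^T$, and entropy potentials $\psi_j(\boldsymbol v)=\boldsymbol v^T\boldsymbol f_j(\boldsymbol u(\boldsymbol v))-F_j(\boldsymbol u(\boldsymbol v))$; $\psi_j(\boldsymbol u)$ means $\psi_j(\boldsymbol v(\boldsymbol u))$. All states are assumed to lie where these maps are defined and smooth. Entropy conservative flux: a bivariate function $\boldsymbol f_{i,S}(\boldsymbol u_L,\boldsymbol u_R)$ with (1) $\boldsymbol f_{i,S}(\boldsymbol u_L,\boldsymbol u_R)=\boldsymbol f_{i,S}(\boldsymbol u_R,\boldsymbol u_L)$; (2) $\boldsymbol f_{i,S}(\boldsymbol u,\boldsymbol u)=\boldsymbol f_i(\boldsymbol u)$; (3) $(\boldsymbol v_L-\boldsymbol v_R)^T\boldsymbol f_{i,S}(\boldsymbol u_L,\boldsymbol u_R)=\psi_i(\boldsymbol u_L)-\psi_i(\boldsymbol u_R)$, where $\boldsymbol v_L=\boldsymbol v(\boldsymbol u_L)$,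 $\boldsymbol v_R=\boldsymbol v(\boldsymbol u_R)$. Reference element: $\hat D\subset\mathbb R^d$ has planar faces with constant unit outward normals with components $\hat n_i$; $P^N(\hat D)$ is the degree $N$ polynomial approximation space with basis $\phi_1,\dots,\phi_{N_p}$. Volume quadrature: points and positive weights $(\hat{\boldsymbol x}_i,\hat w_i)_{i=1}^{N_q}$; surface quadrature: $(\hat{\boldsymbol x}^f_i,\hat w^f_i)_{i=1}^{N_q^f}$ on $\partial\hat D$, with weights given by quadrature on reference faces, and $\hat{\boldsymbol J}_f$ the vector of Jacobian factors from mapping a face of $\hat D$ to the reference face. Assumption on quadrature: the volume rule is exact for polynomials of degree $2N-1$, and for all $u,v\in P^N(\hat D)$ integration by parts $(\partial u/\partial\hat x_i,v)_{\hat D}=\langle u,v\hat n_i\rangle_{\partial\hat D}-(u,\partial v/\partial\hat x_i)_{\hat D}$ holds when the volume and surface integrals are evaluated with quadrature. $\boldsymbol W,\boldsymbol W_f$ are the diagonal matrices of volume and surface weights. $(\boldsymbol V_q)_{ij}=\phi_j(\hat{\boldsymbol x}_i)$, $(\boldsymbol V_f)_{ij}=\phi_j(\hat{\boldsymbol x}^f_i)$. $\boldsymbol D_i$ maps basis coefficients of $u\in P^N(\hat D)$ to basis coefficients of $\partial u/\partial\hat x_i$. $\boldsymbol M=\boldsymbol V_q^T\boldsymbol W\boldsymbol V_q$ (assumed positive definite), $\boldsymbol P_q=\boldsymbol M^{-1}\boldsymbol V_q^T\boldsymbol W$, $\boldsymbol L_q=\boldsymbol M^{-1}\boldsymbol V_f^T\boldsymbol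 W_f$. With $\hat{\boldsymbol n}_i$ the vector of values of $\hat n_i$ at surface points and $\circ$ the Hadamard (entrywise) product, $$\boldsymbol D_N^i=\begin{bmatrix}\boldsymbol V_q\boldsymbol D_i\boldsymbol P_q-\tfrac12\boldsymbol V_q\boldsymbol L_q\,\mathrm{diag}(\hat{\boldsymbol n}_i\circ\hat{\boldsymbol J}_f)\boldsymbol V_f\boldsymbol P_q&\tfrac12\boldsymbol V_q\boldsymbol L_q\,\mathrm{diag}(\hat{\boldsymbol n}_i\circ\hat{\boldsymbol J}_f)\\-\tfrac12\mathrm{diag}(\hat{\boldsymbol n}_i\circ\hat{\boldsymbol J}_f)\boldsymbol V_f\boldsymbol P_q&\tfrac12\mathrm{diag}(\hat{\boldsymbol n}_i\circ\hat{\boldsymbol J}_f)\end{bmatrix},\qquad\boldsymbol W_N=\begin{pmatrix}\boldsymbol W&\\&\boldsymbol W_f\end{pmatrix}.$$ Physical elements: $\Omega\subset\mathbb R^d$ is decomposed into elements $D^k=\boldsymbol\Phi_k(\hat D)$, with $\boldsymbol\Phi_k$ smooth and invertible with Jacobian determinant $J^k>0$. $G^k_{ij}$ denotes $J^k\,\partial\hat x_j/\partial x_i$ (or an approximation of it) and $\boldsymbol G^k_{ij}$ its vector of values at all volume and surface quadrature points, $(\boldsymbol G^k_{ij})_f$ its surface part. $\boldsymbol J^k$ is the vector of values of $J^k$ at volume points; $\boldsymbol n_i$ and $\boldsymbol J^k_f$ are the vectors of values at surface points of the $i$th component of the outward unit normal and of the face Jacobian factor of $D^k$. Mesh assumptions: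 the mesh is quasi-uniform and watertight; on a face shared by $D^k$ and $D^{k,+}$ the surface quadrature points and weights match and $\boldsymbol nJ^k_f=-\boldsymbol n^+J^{k,+}_f$ at all points; and $\sum_{j=1}^d(\boldsymbol G^k_{ij})_f\circ(\hat{\boldsymbol n}_j\circ\hat{\boldsymbol J}_f)=\boldsymbol n_i\circ\boldsymbol J^k_f$. Define $$\boldsymbol D^i_k=\tfrac12\sum_{j=1}^d\left(\mathrm{diag}(\boldsymbol G^k_{ij})\boldsymbol D^j_N+\boldsymbol D^j_N\mathrm{diag}(\boldsymbol G^k_{ij})\right),\quad\boldsymbol Q^i_k=\boldsymbol W_N\boldsymbol D^i_k,\quad\boldsymbol M^k=\boldsymbol V_q^T\boldsymbol W\,\mathrm{diag}(\boldsymbol J^k)\boldsymbol V_q,$$ $$\boldsymbol P^k_q=(\boldsymbol M^k)^{-1}\boldsymbol V_q^T\boldsymbol W\,\mathrm{diag}(\boldsymbol J^k),\qquad\boldsymbol L^k_q=(\boldsymbol M^k)^{-1}\boldsymbol V_f^T\boldsymbol W_f\,\mathrm{diag}(\boldsymbol J^k_f).$$ Conventions: $\boldsymbol 1$ is the vector of all ones. The coefficients $(\boldsymbol u_h)_j\in\mathbb R^n$ are vector-valued and all matrices act componentwise (Kronecker sense); nonlinear functions ($\boldsymbol v(\cdot)$, $\boldsymbol u(\cdot)$, $U$, $\psi_j$, $\boldsymbol f_j$) act pointwise at quadrature points, and $\tilde{\boldsymbol v}_f^T\boldsymbol f_j^*$ is the vector of pointwise inner products in $\mathbb R^n$. $\tilde{\boldsymbol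 u}_f^+$ denotes the values of $\tilde{\boldsymbol u}_f$ on the neighboring element across each face. $\boldsymbol W_{\partial\Omega}$ is the diagonal matrix with $(\boldsymbol W_{\partial\Omega})_{ii}=(\boldsymbol W_f)_{ii}$ if the $i$th surface point of the element lies on $\partial\Omega$, and $0$ otherwise. *)

theory Defs
  imports "HOL-Analysis.Analysis"
begin

section \<open>Vectors and matrices\<close>

text \<open>On the type \<open>real^'a\<close> the library's \<open>*\<close> is the Hadamard product and \<open>1\<close> is
  the vector of all ones.  A family of vector-valued coefficients
  $(u_j)_j$ with $u_j \in R^n$ is an element \<open>u\<close> of \<open>real^'n^'p\<close>, whose rows \<open>u $ j\<close> are
  the coefficients; with this layout the componentwise (Kronecker) action of a scalar matrix
  \<open>A\<close> on \<open>u\<close> is the matrix product \<open>A ** u\<close>.  Volume and surface quadrature points are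
  numbered together by the sum type \<open>'q + 'f\<close>.\<close>

definition diagm :: "real^'a \<Rightarrow> real^'a^'a" where
  "diagm x = (\<chi> i j. if i = j then x $ i else 0)"

definition vec_map :: "('a \<Rightarrow> 'b) \<Rightarrow> 'a^'i \<Rightarrow> 'b^'i" where
  "vec_map g x = (\<chi> i. g (x $ i))"

definition vstack :: "'a^'q::finite \<Rightarrow> 'a^'f::finite \<Rightarrow> 'a^('q + 'f)" where
  "vstack x y = (\<chi> i. case i of Inl a \<Rightarrow> x $ a | Inr b \<Rightarrow> y $ b)"

definition hstack :: "'a^'q::finite^'r \<Rightarrow> 'a^'f::finite^'r \<Rightarrow> 'a^('q + 'f)^'r" where
  "hstack A B = (\<chi> i. vstack (A $ i) (B $ i))"

definition block_matrix ::
  "'a^'q::finite^'q \<Rightarrow> 'a^'f::finite^'q \<Rightarrow> 'a^'q^'f \<Rightarrow> 'a^'f^'f \<Rightarrow> 'a^('q + 'f)^('q + 'f)" where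
  "block_matrix A B C D = vstack (hstack A B) (hstack C D)"

definition surf_part :: "'a^('q::finite + 'f::finite) \<Rightarrow> 'a^'f" where
  "surf_part x = (\<chi> s. x $ Inr s)"

definition had_mat :: "real^'c^'r \<Rightarrow> (real^'n)^'c^'r \<Rightarrow> (real^'n)^'c^'r" where
  "had_mat A X = (\<chi> i j. (A $ i $ j) *\<^sub>R (X $ i $ j))"

text \<open>The product \<open>X 1\<close> of a matrix with entries in $R^n$ and the vector of ones.\<close>

definition row_sums :: "(real^'n)^'c^'r \<Rightarrow> real^'n^'r" where
  "row_sums X = (\<chi> i. \<Sum>j\<in>UNIV. X $ i $ j)"


section \<open>Derivatives and smoothness\<close>

definition partial :: "'d \<Rightarrow> (real^'d \<Rightarrow> real) \<Rightarrow> real^'d \<Rightarrow> real" where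
  "partial i g x = frechet_derivative g (at x) (axis i 1)"

definition grad :: "(real^'d \<Rightarrow> real) \<Rightarrow> real^'d \<Rightarrow> real^'d" where
  "grad g x = (\<chi> i. partial i g x)"

text \<open>For open \<open>S\<close>: \<open>k\<close> times continuously differentiable on \<open>S\<close>.\<close>

primrec Ck_on :: "nat \<Rightarrow> 'a::euclidean_space set \<Rightarrow> ('a \<Rightarrow> 'b::real_normed_vector) \<Rightarrow> bool" where
  "Ck_on 0 S g \<longleftrightarrow> continuous_on S g"
| "Ck_on (Suc k) S g \<longleftrightarrow> (\<forall>x\<in>S. g differentiable (at x)) \<and>
     (\<forall>b\<in>Basis. Ck_on k S (\<lambda>x. frechet_derivative g (at x) b))"

definition smooth_on :: "'a::euclidean_space set \<Rightarrow> ('a \<Rightarrow> 'b::real_normed_vector) \<Rightarrow> bool" where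
  "smooth_on S g \<longleftrightarrow> (\<forall>k. Ck_on k S g)"

text \<open>A smooth invertible parametrization of the image of \<open>S\<close>, smooth up to the boundary of \<open>S\<close>
  in the sense that it extends smoothly to a neighbourhood.\<close>

definition smooth_param :: "(real^'d) set \<Rightarrow> (real^'d \<Rightarrow> real^'d) \<Rightarrow> bool" where
  "smooth_param S \<Psi> \<longleftrightarrow> (\<exists>V. open V \<and> S \<subseteq> V \<and> smooth_on V \<Psi>) \<and> inj_on \<Psi> S \<and>
     (\<forall>x\<in>S. det (jacobian \<Psi> (at x)) \<noteq> 0)"

text \<open>Let \<open>A\<close> be the (invertible) derivative of a map and \<open>c\<close> a unit normal of a hyperplane \<open>H\<close>.
  By Nanson's formula \<open>det A\<close> times the vector \<open>transpose (matrix_inv A) *v c\<close> is the vector area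
  element of the image surface.  Its length is the factor by which \<open>A\<close> scales
  $(d-1)$-dimensional area on \<open>H\<close>.  The vector \<open>push_normal A c\<close> is the unit normal of
  \<open>A ` H\<close> on the side of \<open>A *v c\<close>: it is orthogonal to \<open>A *v \<tau>\<close> for all \<open>\<tau>\<close> orthogonal to
  \<open>c\<close>, and has a positive inner product with \<open>A *v c\<close>.\<close>

definition area_factor :: "real^'d^'d \<Rightarrow> real^'d \<Rightarrow> real" where
  "area_factor A c = \<bar>det A\<bar> * norm (transpose (matrix_inv A) *v c)"

definition push_normal :: "real^'d^'d \<Rightarrow> real^'d \<Rightarrow> real^'d" where
  "push_normal A c = sgn (transpose (matrix_inv A) *v c)"


section \<open>Conservation laws with entropy\<close>

text \<open>\<open>states\<close> is the set of states on which the maps are defined and smooth.\<close>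

record ('d, 'n) conservation_law =
  states :: "(real^'n) set"
  flux :: "'d \<Rightarrow> real^'n \<Rightarrow> real^'n"
  entropy :: "real^'n \<Rightarrow> real"
  entropy_flux :: "'d \<Rightarrow> real^'n \<Rightarrow> real"

definition entropy_vars :: "('d, 'n::finite) conservation_law \<Rightarrow> real^'n \<Rightarrow> real^'n" where
  "entropy_vars C = grad (entropy C)"

definition state_of :: "('d, 'n::finite) conservation_law \<Rightarrow> real^'n \<Rightarrow> real^'n" where
  "state_of C = inv_into (states C) (entropy_vars C)"

definition potential :: "('d, 'n::finite) conservation_law \<Rightarrow> 'd \<Rightarrow> real^'n \<Rightarrow> real" where
  "potential C j v = v \<bullet> flux C j (state_of C v) - entropy_flux C j (state_of C v)"

definition entropy_system :: "('d, 'n::finite) conservation_law \<Rightarrow> bool" where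
  "entropy_system C \<longleftrightarrow>
     open (states C) \<and>
     convex_on (states C) (entropy C) \<and>
     smooth_on (states C) (entropy C) \<and>
     smooth_on (states C) (entropy_vars C) \<and>
     inj_on (entropy_vars C) (states C) \<and>
     smooth_on (entropy_vars C ` states C) (state_of C) \<and>
     (\<forall>j. smooth_on (states C) (flux C j) \<and> smooth_on (states C) (entropy_flux C j) \<and>
       (\<forall>u\<in>states C. entropy_vars C u v* jacobian (flux C j) (at u) = grad (entropy_flux C j) u))"

definition entropy_conservative_flux ::
  "('d, 'n::finite) conservation_law \<Rightarrow> 'd \<Rightarrow> (real^'n \<Rightarrow> real^'n \<Rightarrow> real^'n) \<Rightarrow> bool" where
  "entropy_conservative_flux C i fS \<longleftrightarrow>
     (\<forall>uL\<in>states C. \<forall>uR\<in>states C. fS uL uR = fS uR uL) \<and>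
     (\<forall>u\<in>states C. fS u u = flux C i u) \<and>
     (\<forall>uL\<in>states C. \<forall>uR\<in>states C.
       (entropy_vars C uL - entropy_vars C uR) \<bullet> fS uL uR =
         potential C i (entropy_vars C uL) - potential C i (entropy_vars C uR))"


section \<open>Reference element\<close>

text \<open>The polynomials of total degree at most \<open>m\<close> in \<open>CARD('d)\<close> variables.\<close>

definition polys :: "nat \<Rightarrow> (real^'d \<Rightarrow> real) set" where
  "polys m = {p. \<exists>c. p = (\<lambda>x. \<Sum>\<alpha> | sum \<alpha> UNIV \<le> m. c \<alpha> * (\<Prod>j\<in>UNIV. x $ j ^ \<alpha> j))}"

text \<open>Each face \<open>e\<close> of the element \<open>elt\<close> is the image \<open>face_map e ` ref_face e\<close> of a reference face,
  placed in the hyperplane of $R^d$ with unit normal \<open>ref_normal e\<close>.  The surface quadrature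
  (points \<open>y_surf\<close>, weights \<open>w_surf\<close>) is given on the reference faces; \<open>surf_face\<close> tells which face
  a surface point belongs to, which matters for points lying on several faces.\<close>

record ('d, 'e, 'p, 'q, 'f) ref_element =
  elt :: "(real^'d) set"
  normal :: "'e \<Rightarrow> real^'d"
  ref_face :: "'e \<Rightarrow> (real^'d) set"
  ref_normal :: "'e \<Rightarrow> real^'d"
  face_map :: "'e \<Rightarrow> real^'d \<Rightarrow> real^'d"
  deg :: nat
  basis :: "'p \<Rightarrow> real^'d \<Rightarrow> real"
  diff_matrix :: "'d \<Rightarrow> real^'p^'p"
  x_vol :: "'q \<Rightarrow> real^'d"
  w_vol :: "real^'q"
  surf_face :: "'f \<Rightarrow> 'e"
  y_surf :: "'f \<Rightarrow> real^'d"
  w_surf :: "real^'f"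

definition face :: "('d::finite, 'e, 'p::finite, 'q::finite, 'f::finite) ref_element \<Rightarrow> 'e \<Rightarrow> (real^'d) set" where
  "face R e = face_map R e ` ref_face R e"

definition x_surf :: "('d::finite, 'e, 'p::finite, 'q::finite, 'f::finite) ref_element \<Rightarrow> 'f \<Rightarrow> real^'d" where
  "x_surf R s = face_map R (surf_face R s) (y_surf R s)"

definition nhat :: "('d::finite, 'e, 'p::finite, 'q::finite, 'f::finite) ref_element \<Rightarrow> 'd \<Rightarrow> real^'f" where
  "nhat R i = (\<chi> s. normal R (surf_face R s) $ i)"

definition Jhat :: "('d::finite, 'e, 'p::finite, 'q::finite, 'f::finite) ref_element \<Rightarrow> real^'f" where
  "Jhat R = (\<chi> s. area_factor (jacobian (face_map R (surf_face R s)) (at (y_surf R s)))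
                     (ref_normal R (surf_face R s)))"

definition expand :: "('d::finite, 'e, 'p::finite, 'q::finite, 'f::finite) ref_element \<Rightarrow> real^'p \<Rightarrow> real^'d \<Rightarrow> real" where
  "expand R a x = (\<Sum>j\<in>UNIV. a $ j * basis R j x)"

text \<open>At every point in the relative interior of the face \<open>F\<close>, the set \<open>D\<close> is locally the half
  space with outward normal \<open>n\<close>.\<close>

definition planar_face :: "(real^'d) set \<Rightarrow> (real^'d) set \<Rightarrow> real^'d \<Rightarrow> bool" where
  "planar_face D F n \<longleftrightarrow>
     closed F \<and> aff_dim F = int CARD('d) - 1 \<and> norm n = 1 \<and>
     (\<forall>x\<in>rel_interior F. \<exists>\<epsilon>>0. D \<inter> ball x \<epsilon> = {y \<in> ball x \<epsilon>. n \<bullet> (y - x) \<le> 0})"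

definition ref_geometry :: "('d::finite, 'e::finite, 'p::finite, 'q::finite, 'f::finite) ref_element \<Rightarrow> bool" where
  "ref_geometry R \<longleftrightarrow>
     compact (elt R) \<and> elt R \<noteq> {} \<and> elt R = closure (interior (elt R)) \<and>
     frontier (elt R) = (\<Union>e. face R e) \<and>
     (\<forall>e. planar_face (elt R) (face R e) (normal R e)) \<and>
     (\<forall>e e'. e \<noteq> e' \<longrightarrow> rel_interior (face R e) \<inter> rel_interior (face R e') = {}) \<and>
     (\<forall>e. norm (ref_normal R e) = 1 \<and> ref_face R e \<subseteq> {y. ref_normal R e \<bullet> y = 0} \<and>
          smooth_param (ref_face R e) (face_map R e))"

definition approx_space :: "('d::finite, 'e, 'p::finite, 'q::finite, 'f::finite) ref_element \<Rightarrow> bool" where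
  "approx_space R \<longleftrightarrow>
     bij_betw (expand R) UNIV (polys (deg R)) \<and>
     (\<forall>i a. expand R (diff_matrix R i *v a) = partial i (expand R a))"

text \<open>Exactness for degree \<open>2 N - 1\<close> is written with \<open>m < 2 * N\<close>, as there is no condition for
  \<open>N = 0\<close>.\<close>

definition quadrature_rules :: "('d::finite, 'e, 'p::finite, 'q::finite, 'f::finite) ref_element \<Rightarrow> bool" where
  "quadrature_rules R \<longleftrightarrow>
     (\<forall>i. x_vol R i \<in> elt R \<and> w_vol R $ i > 0) \<and>
     (\<forall>s. y_surf R s \<in> ref_face R (surf_face R s)) \<and>
     (\<forall>m<2 * deg R. \<forall>p\<in>polys m.
        (p has_integral (\<Sum>i\<in>UNIV. w_vol R $ i * p (x_vol R i))) (elt R)) \<and>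
     (\<forall>i. \<forall>u\<in>polys (deg R). \<forall>v\<in>polys (deg R).
        (\<Sum>q\<in>UNIV. w_vol R $ q * (partial i u (x_vol R q) * v (x_vol R q))) =
        (\<Sum>s\<in>UNIV. w_surf R $ s * Jhat R $ s * (u (x_surf R s) * (v (x_surf R s) * nhat R i $ s)))
        - (\<Sum>q\<in>UNIV. w_vol R $ q * (u (x_vol R q) * partial i v (x_vol R q))))"


subsection \<open>Reference matrices\<close>

definition Vq :: "('d::finite, 'e, 'p::finite, 'q::finite, 'f::finite) ref_element \<Rightarrow> real^'p^'q" where
  "Vq R = (\<chi> i j. basis R j (x_vol R i))"

definition Vf :: "('d::finite, 'e, 'p::finite, 'q::finite, 'f::finite) ref_element \<Rightarrow> real^'p^'f" where
  "Vf R = (\<chi> i j. basis R j (x_surf R i))"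

definition W :: "('d::finite, 'e, 'p::finite, 'q::finite, 'f::finite) ref_element \<Rightarrow> real^'q^'q" where
  "W R = diagm (w_vol R)"

definition Wf :: "('d::finite, 'e, 'p::finite, 'q::finite, 'f::finite) ref_element \<Rightarrow> real^'f^'f" where
  "Wf R = diagm (w_surf R)"

definition Mass :: "('d::finite, 'e, 'p::finite, 'q::finite, 'f::finite) ref_element \<Rightarrow> real^'p^'p" where
  "Mass R = transpose (Vq R) ** W R ** Vq R"

definition Pq :: "('d::finite, 'e, 'p::finite, 'q::finite, 'f::finite) ref_element \<Rightarrow> real^'q^'p" where
  "Pq R = matrix_inv (Mass R) ** transpose (Vq R) ** W R"

definition Lq :: "('d::finite, 'e, 'p::finite, 'q::finite, 'f::finite) ref_element \<Rightarrow> real^'f^'p" where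
  "Lq R = matrix_inv (Mass R) ** transpose (Vf R) ** Wf R"

definition DN :: "('d::finite, 'e, 'p::finite, 'q::finite, 'f::finite) ref_element \<Rightarrow> 'd \<Rightarrow> real^('q + 'f)^('q + 'f)" where
  "DN R i = (let B = diagm (nhat R i * Jhat R) in
     block_matrix
       (Vq R ** diff_matrix R i ** Pq R - (1/2) *\<^sub>R (Vq R ** Lq R ** B ** Vf R ** Pq R))
       ((1/2) *\<^sub>R (Vq R ** Lq R ** B))
       (- (1/2) *\<^sub>R (B ** Vf R ** Pq R))
       ((1/2) *\<^sub>R B))"

definition WN :: "('d::finite, 'e, 'p::finite, 'q::finite, 'f::finite) ref_element \<Rightarrow> real^('q + 'f)^('q + 'f)" where
  "WN R = block_matrix (W R) 0 0 (Wf R)"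

definition reference_element :: "('d::finite, 'e::finite, 'p::finite, 'q::finite, 'f::finite) ref_element \<Rightarrow> bool" where
  "reference_element R \<longleftrightarrow> ref_geometry R \<and> approx_space R \<and> quadrature_rules R \<and>
     (\<forall>a. a \<noteq> 0 \<longrightarrow> a \<bullet> (Mass R *v a) > 0)"


section \<open>Mesh of physical elements\<close>

text \<open>The elements are numbered by the finite type \<open>'k\<close>.  \<open>geo k i j\<close> holds the values of
  \<open>G k i j\<close> at all volume and surface points; it may be any approximation of the geometric terms.
  \<open>nbr_face\<close> and \<open>nbr_point\<close> give the other side of an interior face and of a
  surface quadrature point on such a face; their values elsewhere are irrelevant.\<close>

record ('d, 'k, 'e, 'q::finite, 'f::finite) mesh =
  domain :: "(real^'d) set"
  mapping :: "'k \<Rightarrow> real^'d \<Rightarrow> real^'d"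
  geo :: "'k \<Rightarrow> 'd \<Rightarrow> 'd \<Rightarrow> real^('q::finite + 'f::finite)"
  nbr_face :: "'k \<times> 'e \<Rightarrow> 'k \<times> 'e"
  nbr_point :: "'k \<times> 'f \<Rightarrow> 'k \<times> 'f"

definition phys_elt ::
  "('d::finite, 'e, 'p::finite, 'q::finite, 'f::finite) ref_element \<Rightarrow> ('d, 'k, 'e, 'q, 'f) mesh \<Rightarrow> 'k \<Rightarrow> (real^'d) set" where
  "phys_elt R \<T> k = mapping \<T> k ` elt R"

definition phys_face ::
  "('d::finite, 'e, 'p::finite, 'q::finite, 'f::finite) ref_element \<Rightarrow> ('d, 'k, 'e, 'q, 'f) mesh \<Rightarrow> 'k \<Rightarrow> 'e \<Rightarrow> (real^'d) set" where
  "phys_face R \<T> k e = mapping \<T> k ` face R e"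

definition phys_point ::
  "('d::finite, 'e, 'p::finite, 'q::finite, 'f::finite) ref_element \<Rightarrow> ('d, 'k, 'e, 'q, 'f) mesh \<Rightarrow> 'k \<Rightarrow> 'f \<Rightarrow> real^'d" where
  "phys_point R \<T> k s = mapping \<T> k (x_surf R s)"

definition boundary_face ::
  "('d::finite, 'e, 'p::finite, 'q::finite, 'f::finite) ref_element \<Rightarrow> ('d, 'k, 'e, 'q, 'f) mesh \<Rightarrow> 'k \<Rightarrow> 'e \<Rightarrow> bool" where
  "boundary_face R \<T> k e \<longleftrightarrow> phys_face R \<T> k e \<subseteq> frontier (domain \<T>)"

definition Jvec ::
  "('d::finite, 'e, 'p::finite, 'q::finite, 'f::finite) ref_element \<Rightarrow> ('d, 'k, 'e, 'q, 'f) mesh \<Rightarrow> 'k \<Rightarrow> real^'q" where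
  "Jvec R \<T> k = (\<chi> i. det (jacobian (mapping \<T> k) (at (x_vol R i))))"

definition nvec ::
  "('d::finite, 'e, 'p::finite, 'q::finite, 'f::finite) ref_element \<Rightarrow> ('d, 'k, 'e, 'q, 'f) mesh \<Rightarrow> 'k \<Rightarrow> 'd \<Rightarrow> real^'f" where
  "nvec R \<T> k i = (\<chi> s.
     push_normal (jacobian (mapping \<T> k) (at (x_surf R s))) (normal R (surf_face R s)) $ i)"

text \<open>Area factor of the composition of the mapping with the map from the reference face.\<close>

definition Jfvec ::
  "('d::finite, 'e, 'p::finite, 'q::finite, 'f::finite) ref_element \<Rightarrow> ('d, 'k, 'e, 'q, 'f) mesh \<Rightarrow> 'k \<Rightarrow> real^'f" where
  "Jfvec R \<T> k = (\<chi> s.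
     area_factor (jacobian (mapping \<T> k) (at (x_surf R s))) (normal R (surf_face R s)) * Jhat R $ s)"

definition W_boundary ::
  "('d::finite, 'e, 'p::finite, 'q::finite, 'f::finite) ref_element \<Rightarrow> ('d, 'k, 'e, 'q, 'f) mesh \<Rightarrow> 'k \<Rightarrow> real^'f^'f" where
  "W_boundary R \<T> k =
     diagm (\<chi> s. if phys_point R \<T> k s \<in> frontier (domain \<T>) then w_surf R $ s else 0)"

definition decomposition ::
  "('d::finite, 'e, 'p::finite, 'q::finite, 'f::finite) ref_element \<Rightarrow> ('d, 'k::finite, 'e, 'q, 'f) mesh \<Rightarrow> bool" where
  "decomposition R \<T> \<longleftrightarrow>
     (\<forall>k. smooth_param (elt R) (mapping \<T> k) \<and>
          (\<forall>x\<in>elt R. det (jacobian (mapping \<T> k) (at x)) > 0)) \<and>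
     closure (domain \<T>) = (\<Union>k. phys_elt R \<T> k) \<and>
     (\<forall>k k'. k \<noteq> k' \<longrightarrow> interior (phys_elt R \<T> k) \<inter> interior (phys_elt R \<T> k') = {})"

definition watertight ::
  "('d::finite, 'e, 'p::finite, 'q::finite, 'f::finite) ref_element \<Rightarrow> ('d, 'k::finite, 'e, 'q, 'f) mesh \<Rightarrow> bool" where
  "watertight R \<T> \<longleftrightarrow>
     (\<forall>k e k' e'. \<not> boundary_face R \<T> k e \<longrightarrow> nbr_face \<T> (k, e) = (k', e') \<longrightarrow>
        k' \<noteq> k \<and> nbr_face \<T> (k', e') = (k, e) \<and> phys_face R \<T> k' e' = phys_face R \<T> k e)"

definition matching_quadrature ::
  "('d::finite, 'e, 'p::finite, 'q::finite, 'f::finite) ref_element \<Rightarrow> ('d, 'k::finite, 'e, 'q, 'f) mesh \<Rightarrow> bool" where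
  "matching_quadrature R \<T> \<longleftrightarrow>
     (\<forall>k s k' s'. \<not> boundary_face R \<T> k (surf_face R s) \<longrightarrow> nbr_point \<T> (k, s) = (k', s') \<longrightarrow>
        nbr_face \<T> (k, surf_face R s) = (k', surf_face R s') \<and> nbr_point \<T> (k', s') = (k, s) \<and>
        phys_point R \<T> k' s' = phys_point R \<T> k s \<and> w_surf R $ s' = w_surf R $ s \<and>
        (\<forall>i. nvec R \<T> k i $ s * Jfvec R \<T> k $ s = - (nvec R \<T> k' i $ s' * Jfvec R \<T> k' $ s')))"

definition consistent_geometric_terms ::
  "('d::finite, 'e, 'p::finite, 'q::finite, 'f::finite) ref_element \<Rightarrow> ('d, 'k::finite, 'e, 'q, 'f) mesh \<Rightarrow> bool" where
  "consistent_geometric_terms R \<T> \<longleftrightarrow>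
     (\<forall>k i. (\<Sum>j\<in>UNIV. surf_part (geo \<T> k i j) * (nhat R j * Jhat R)) = nvec R \<T> k i * Jfvec R \<T> k)"

text \<open>Every element contains a ball of radius at least \<open>\<rho>\<close> times the mesh size.\<close>

definition quasi_uniform ::
  "real \<Rightarrow> ('d::finite, 'e, 'p::finite, 'q::finite, 'f::finite) ref_element \<Rightarrow> ('d, 'k::finite, 'e, 'q, 'f) mesh \<Rightarrow> bool" where
  "quasi_uniform \<rho> R \<T> \<longleftrightarrow> \<rho> > 0 \<and>
     (\<forall>k k'. \<exists>x. ball x (\<rho> * diameter (phys_elt R \<T> k')) \<subseteq> phys_elt R \<T> k)"

definition admissible_mesh ::
  "('d::finite, 'e, 'p::finite, 'q::finite, 'f::finite) ref_element \<Rightarrow> ('d, 'k::finite, 'e, 'q, 'f) mesh \<Rightarrow> bool" where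
  "admissible_mesh R \<T> \<longleftrightarrow> decomposition R \<T> \<and> watertight R \<T> \<and> matching_quadrature R \<T> \<and>
     consistent_geometric_terms R \<T>"


subsection \<open>Matrices on physical elements\<close>

definition Dk ::
  "('d::finite, 'e, 'p::finite, 'q::finite, 'f::finite) ref_element \<Rightarrow> ('d, 'k, 'e, 'q, 'f) mesh \<Rightarrow> 'k \<Rightarrow> 'd \<Rightarrow> real^('q + 'f)^('q + 'f)" where
  "Dk R \<T> k i = (1/2) *\<^sub>R
     (\<Sum>j\<in>UNIV. diagm (geo \<T> k i j) ** DN R j + DN R j ** diagm (geo \<T> k i j))"

definition Qk ::
  "('d::finite, 'e, 'p::finite, 'q::finite, 'f::finite) ref_element \<Rightarrow> ('d, 'k, 'e, 'q, 'f) mesh \<Rightarrow> 'k \<Rightarrow> 'd \<Rightarrow> real^('q + 'f)^('q + 'f)" where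
  "Qk R \<T> k i = WN R ** Dk R \<T> k i"

definition Mk ::
  "('d::finite, 'e, 'p::finite, 'q::finite, 'f::finite) ref_element \<Rightarrow> ('d, 'k, 'e, 'q, 'f) mesh \<Rightarrow> 'k \<Rightarrow> real^'p^'p" where
  "Mk R \<T> k = transpose (Vq R) ** W R ** diagm (Jvec R \<T> k) ** Vq R"

definition Pqk ::
  "('d::finite, 'e, 'p::finite, 'q::finite, 'f::finite) ref_element \<Rightarrow> ('d, 'k, 'e, 'q, 'f) mesh \<Rightarrow> 'k \<Rightarrow> real^'q^'p" where
  "Pqk R \<T> k = matrix_inv (Mk R \<T> k) ** transpose (Vq R) ** W R ** diagm (Jvec R \<T> k)"

definition Lqk ::
  "('d::finite, 'e, 'p::finite, 'q::finite, 'f::finite) ref_element \<Rightarrow> ('d, 'k, 'e, 'q, 'f) mesh \<Rightarrow> 'k \<Rightarrow> real^'f^'p" where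
  "Lqk R \<T> k = matrix_inv (Mk R \<T> k) ** transpose (Vf R) ** Wf R ** diagm (Jfvec R \<T> k)"


section \<open>The semi-discrete scheme\<close>

text \<open>\<open>c\<close> always stands for the coefficients of the solution on one element, and \<open>cs\<close> for those
  on all elements, at a fixed time.\<close>

definition u_quad ::
  "('d::finite, 'e, 'p::finite, 'q::finite, 'f::finite) ref_element \<Rightarrow> real^'n^'p \<Rightarrow> real^'n^'q" where
  "u_quad R c = Vq R ** c"

definition v_proj ::
  "('d::finite, 'n::finite) conservation_law \<Rightarrow> ('d, 'e, 'p::finite, 'q::finite, 'f::finite) ref_element \<Rightarrow>
   ('d, 'k, 'e, 'q, 'f) mesh \<Rightarrow> 'k \<Rightarrow> real^'n^'p \<Rightarrow> real^'n^'p" where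
  "v_proj C R \<T> k c = Pqk R \<T> k ** vec_map (entropy_vars C) (u_quad R c)"

definition v_tilde ::
  "('d::finite, 'n::finite) conservation_law \<Rightarrow> ('d, 'e, 'p::finite, 'q::finite, 'f::finite) ref_element \<Rightarrow>
   ('d, 'k, 'e, 'q, 'f) mesh \<Rightarrow> 'k \<Rightarrow> real^'n^'p \<Rightarrow> real^'n^('q + 'f)" where
  "v_tilde C R \<T> k c = vstack (Vq R) (Vf R) ** v_proj C R \<T> k c"

definition u_tilde ::
  "('d::finite, 'n::finite) conservation_law \<Rightarrow> ('d, 'e, 'p::finite, 'q::finite, 'f::finite) ref_element \<Rightarrow>
   ('d, 'k, 'e, 'q, 'f) mesh \<Rightarrow> 'k \<Rightarrow> real^'n^'p \<Rightarrow> real^'n^('q + 'f)" where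
  "u_tilde C R \<T> k c = vec_map (state_of C) (v_tilde C R \<T> k c)"

definition flux_matrix ::
  "(real^'n \<Rightarrow> real^'n \<Rightarrow> real^'n) \<Rightarrow> (real^'n)^'m \<Rightarrow> (real^'n)^'m^'m" where
  "flux_matrix fS u = (\<chi> m l. fS (u $ m) (u $ l))"

text \<open>\<open>g j k s\<close> is the value, at the surface point \<open>s\<close> of element \<open>k\<close>, of the \<open>j\<close>-th component of
  the numerical flux that imposes the boundary conditions; it is used on boundary faces only.\<close>

definition flux_star ::
  "('d::finite, 'n::finite) conservation_law \<Rightarrow> ('d, 'e, 'p::finite, 'q::finite, 'f::finite) ref_element \<Rightarrow>
   ('d, 'k, 'e, 'q, 'f) mesh \<Rightarrow> ('d \<Rightarrow> real^'n \<Rightarrow> real^'n \<Rightarrow> real^'n) \<Rightarrow>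
   ('d \<Rightarrow> 'k \<Rightarrow> 'f \<Rightarrow> real^'n) \<Rightarrow> ('k \<Rightarrow> real^'n^'p) \<Rightarrow> 'k \<Rightarrow> 'd \<Rightarrow> real^'n^'f" where
  "flux_star C R \<T> fS g cs k j = (\<chi> s.
     if boundary_face R \<T> k (surf_face R s) then g j k s
     else (case nbr_point \<T> (k, s) of (k', s') \<Rightarrow>
       fS j (u_tilde C R \<T> k' (cs k') $ Inr s') (u_tilde C R \<T> k (cs k) $ Inr s)))"

definition scheme_terms ::
  "('d::finite, 'n::finite) conservation_law \<Rightarrow> ('d, 'e, 'p::finite, 'q::finite, 'f::finite) ref_element \<Rightarrow>
   ('d, 'k, 'e, 'q, 'f) mesh \<Rightarrow> ('d \<Rightarrow> real^'n \<Rightarrow> real^'n \<Rightarrow> real^'n) \<Rightarrow>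
   ('d \<Rightarrow> 'k \<Rightarrow> 'f \<Rightarrow> real^'n) \<Rightarrow> ('k \<Rightarrow> real^'n^'p) \<Rightarrow> 'k \<Rightarrow> real^'n^'p" where
  "scheme_terms C R \<T> fS g cs k =
     matrix_inv (Mk R \<T> k) ** hstack (transpose (Vq R) ** W R) (transpose (Vf R) ** Wf R) **
       (\<Sum>j\<in>UNIV. row_sums (had_mat (2 *\<^sub>R Dk R \<T> k j)
                                  (flux_matrix (fS j) (u_tilde C R \<T> k (cs k)))))
     + (\<Sum>j\<in>UNIV. Lqk R \<T> k ** diagm (nvec R \<T> k j) **
          (flux_star C R \<T> fS g cs k j
           - vec_map (flux C j) (surf_part (u_tilde C R \<T> k (cs k)))))"

definition solves_scheme ::
  "('d::finite, 'n::finite) conservation_law \<Rightarrow> ('d, 'e, 'p::finite, 'q::finite, 'f::finite) ref_element \<Rightarrow>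
   ('d, 'k, 'e, 'q, 'f) mesh \<Rightarrow> ('d \<Rightarrow> real^'n \<Rightarrow> real^'n \<Rightarrow> real^'n) \<Rightarrow>
   (real \<Rightarrow> 'd \<Rightarrow> 'k \<Rightarrow> 'f \<Rightarrow> real^'n) \<Rightarrow> real set \<Rightarrow> ('k \<Rightarrow> real \<Rightarrow> real^'n^'p) \<Rightarrow> bool" where
  "solves_scheme C R \<T> fS g T uh \<longleftrightarrow>
     (\<forall>t\<in>T. \<forall>k. \<exists>u'. (uh k has_vector_derivative u') (at t) \<and>
        u' + scheme_terms C R \<T> fS (g t) (\<lambda>l. uh l t) k = 0)"

text \<open>All states that occur lie where the changes of variables are defined.\<close>

definition admissible_states ::
  "('d::finite, 'n::finite) conservation_law \<Rightarrow> ('d, 'e, 'p::finite, 'q::finite, 'f::finite) ref_element \<Rightarrow>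
   ('d, 'k, 'e, 'q, 'f) mesh \<Rightarrow> real set \<Rightarrow> ('k \<Rightarrow> real \<Rightarrow> real^'n^'p) \<Rightarrow> bool" where
  "admissible_states C R \<T> T uh \<longleftrightarrow>
     (\<forall>t\<in>T. \<forall>k. (\<forall>i. u_quad R (uh k t) $ i \<in> states C) \<and>
                (\<forall>m. v_tilde C R \<T> k (uh k t) $ m \<in> entropy_vars C ` states C))"

end

theory Submission
  imports Defs
begin

text \<open>
  Test the scheme on one element with the coefficients $v_h$ of the projected entropy variables.
  Because $v_h$ is the projection of $v(u_q)$ in the $J^k$-weighted inner product and
  $du_q/dt$ lies in the approximation space, the chain rule $dU/dt = v \cdot du/dt$ turns
  the quadrature of $dU(u_q)/dt$ into $v_h \cdot M^k\, du_h/dt$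
  (\<open>entropy_rate_eq_projected_rate\<close>), where $du_h/dt$ can be replaced by the scheme.

  What remains is algebra at quadrature points.  The quadrature version of integration by parts makes
  $W_N D_N^i$ a summation-by-parts operator: its symmetric part is diagonal and supported on
  the surface points (\<open>reference_summation_by_parts\<close>).  Averaging with the geometric terms
  keeps this property, with the physical scaled normals as boundary weights
  (\<open>Qk_summation_by_parts\<close>).  For such a $Q$ with $Q 1 = 0$, the
  condition on $(v_L - v_R) \cdot f_S(u_L,u_R)$ makes the flux-differencing volume term telescope to boundary data
  (\<open>flux_differencing_balance\<close>).  The consistent flux $f_j(\tilde u_f)$ cancels against the same
  term in the surface correction, so that an element changes its entropy exactly by
  $\sum_j \sum_s w_s (n_j J_f)_s (\psi_j - \tilde v_f \cdot f_j^*)_s$ (\<open>element_entropy_balance\<close>).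

  Summed over the mesh, the surface points that are not on $\partial\Omega$ come in pairs with
  opposite $n J_f$.  Both members see the same flux by symmetry, and the entropy condition says
  that $\psi_j - \tilde v_f \cdot f_j^*$ has the same value on both sides, so each pair
  contributes zero (\<open>interface_contributions_cancel\<close>).  The surviving terms are those weighted by
  $W_{\partial\Omega}$.
\<close>

section \<open>Matrix algebra\<close>

lemma matrix_mult_row:
  fixes A :: "real^'p^'q" and x :: "real^'n^'p"
  shows "(A ** x) $ i = (\<Sum>j\<in>UNIV. A $ i $ j *\<^sub>R x $ j)"
  by (simp add: vec_eq_iff matrix_matrix_mult_def)

text \<open>The componentwise action of a scalar matrix on vectors of states has the transposed matrix as its
  adjoint for the total inner product over all coefficients and all components.\<close>

lemma inner_matrix_mult:
  fixes A :: "real^'p^'q" and x :: "real^'n^'p" and y :: "real^'n^'q"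
  shows "(A ** x) \<bullet> y = x \<bullet> (transpose A ** y)"
proof -
  have "(A ** x) \<bullet> y = (\<Sum>i\<in>UNIV. \<Sum>j\<in>UNIV. A $ i $ j * (x $ j \<bullet> y $ i))"
    by (simp add: inner_vec_def[of "A ** x"] matrix_mult_row inner_sum_left del: inner_real_def)
  also have "\<dots> = (\<Sum>j\<in>UNIV. \<Sum>i\<in>UNIV. A $ i $ j * (x $ j \<bullet> y $ i))"
    by (rule sum.swap)
  also have "\<dots> = x \<bullet> (transpose A ** y)"
    by (simp add: inner_vec_def[of x] matrix_mult_row inner_sum_right transpose_def)
  finally show ?thesis .
qed

lemma diagm_mult_row:
  fixes x :: "real^'a" and y :: "real^'n^'a"
  shows "(diagm x ** y) $ i = x $ i *\<^sub>R y $ i"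
  by (simp add: matrix_mult_row diagm_def if_distrib[of "\<lambda>c. c *\<^sub>R _"] sum.delta cong: if_cong)

lemma mult_diagm_nth:
  fixes x :: "real^'a" and A :: "real^'a^'b"
  shows "(A ** diagm x) $ i $ j = A $ i $ j * x $ j"
  by (simp add: matrix_matrix_mult_def diagm_def if_distrib[of "\<lambda>c. _ * c"] sum.delta cong: if_cong)

lemma diagm_mult_diagm: "diagm x ** diagm y = diagm (x * y)"
  by (simp add: vec_eq_iff diagm_mult_row) (simp add: diagm_def)

lemma transpose_diagm [simp]: "transpose (diagm x) = diagm x"
  by (auto simp: vec_eq_iff transpose_def diagm_def)

lemma one_inner_diagm: "1 \<bullet> (diagm x *v y) = (\<Sum>i\<in>UNIV. x $ i * y $ i)"
  by (simp add: inner_vec_def matrix_vector_mult_def diagm_def if_distrib[of "\<lambda>c. c * _"] sum.delta cong: if_cong)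

lemma vstack_nth [simp]: "vstack x y $ Inl a = x $ a" "vstack x y $ Inr b = y $ b"
  by (simp_all add: vstack_def)

lemma sum_UNIV_Plus:
  fixes h :: "'q::finite + 'f::finite \<Rightarrow> 'a::comm_monoid_add"
  shows "(\<Sum>m\<in>UNIV. h m) = (\<Sum>a\<in>UNIV. h (Inl a)) + (\<Sum>b\<in>UNIV. h (Inr b))"
  by (simp add: UNIV_Plus_UNIV[symmetric] sum.Plus o_def del: UNIV_Plus_UNIV)

lemma all_sum_iff: "(\<forall>m. P m) \<longleftrightarrow> (\<forall>a. P (Inl a)) \<and> (\<forall>b. P (Inr b))"
  by (metis sum.exhaust)

lemma block_matrix_nth [simp]:
  "block_matrix A B C D $ Inl a $ Inl a' = A $ a $ a'"
  "block_matrix A B C D $ Inl a $ Inr b' = B $ a $ b'"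
  "block_matrix A B C D $ Inr b $ Inl a' = C $ b $ a'"
  "block_matrix A B C D $ Inr b $ Inr b' = D $ b $ b'"
  by (simp_all add: block_matrix_def hstack_def)

lemma matrix_mult_scaleR:
  fixes A :: "real^'b^'a" and B :: "real^'c^'b"
  shows "(r *\<^sub>R A) ** B = r *\<^sub>R (A ** B)" "A ** (r *\<^sub>R B) = r *\<^sub>R (A ** B)"
  by (simp_all add: vec_eq_iff matrix_matrix_mult_def sum_distrib_left mult_ac)

lemma matrix_mult_diff:
  fixes A A' :: "real^'b^'a" and B B' :: "real^'c^'b"
  shows "(A - A') ** B = A ** B - A' ** B" "A ** (B - B') = A ** B - A ** B'"
  by (simp_all add: vec_eq_iff matrix_matrix_mult_def sum_subtractf algebra_simps)

lemma matrix_add_mult: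
  fixes A A' :: "real^'b^'a" and B :: "real^'c^'b"
  shows "(A + A') ** B = A ** B + A' ** B"
  by (simp add: vec_eq_iff matrix_matrix_mult_def sum.distrib algebra_simps)

lemma transpose_diff_minus:
  fixes A B :: "real^'b^'a"
  shows "transpose (A - B) = transpose A - transpose B" "transpose (- A) = - transpose A"
  by (simp_all add: vec_eq_iff transpose_def)

lemma invertible_mult_matrix_inv:
  assumes "invertible A"
  shows "A ** matrix_inv A = mat 1"
  using someI_ex[OF assms[unfolded invertible_def]] by (simp add: matrix_inv_def)

lemma inner_transpose_mult_vec:
  fixes A :: "real^'b^'a"
  shows "x \<bullet> (transpose A *v y) = (A *v x) \<bullet> y"
  by (metis dot_lmul_matrix inner_commute transpose_matrix_vector)

lemma WN_eq_diagm: "WN R = diagm (vstack (w_vol R) (w_surf R))"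
  by (simp add: vec_eq_iff all_sum_iff WN_def W_def Wf_def) (simp add: diagm_def)

lemma diagm_vstack_mult_block_matrix:
  "diagm (vstack x y) ** block_matrix A B C D =
     block_matrix (diagm x ** A) (diagm x ** B) (diagm y ** C) (diagm y ** D)"
  by (simp add: vec_eq_iff all_sum_iff diagm_mult_row)

lemma transpose_block_matrix:
  "transpose (block_matrix A B C D) =
     block_matrix (transpose A) (transpose C) (transpose B) (transpose D)"
  by (simp add: vec_eq_iff all_sum_iff transpose_def)

lemma block_matrix_add:
  "block_matrix A B C D + block_matrix A' B' C' D' = block_matrix (A + A') (B + B') (C + C') (D + D')"
  by (simp add: vec_eq_iff all_sum_iff)

lemma pos_def_imp_invertible:
  fixes A :: "real^'a^'a"
  assumes "\<And>a. a \<noteq> 0 \<Longrightarrow> a \<bullet> (A *v a) > 0"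
  shows "invertible A"
proof -
  have "\<forall>a. A *v a = 0 \<longrightarrow> a = 0"
    using assms by (metis inner_zero_right less_irrefl)
  then show ?thesis
    by (simp add: invertible_left_inverse matrix_left_invertible_ker)
qed

section \<open>Summation by parts on the reference element\<close>

lemma Mass_symmetric: "transpose (Mass R) = Mass R"
  by (simp add: Mass_def W_def matrix_transpose_mul matrix_mul_assoc)

lemma bilinear_entries:
  fixes A :: "real^'b^'a"
  shows "axis i 1 \<bullet> (A *v axis j 1) = A $ i $ j"
  by (simp add: inner_axis' matrix_vector_mul_component inner_axis)

text \<open>Identities between matrices are read off from their bilinear forms, which for the mass and
  differentiation matrices are discrete integrals of polynomials.\<close>

lemma matrix_eq_bilinear:
  fixes A B :: "real^'b^'a"
  assumes "\<And>x y. x \<bullet> (A *v y) = x \<bullet> (B *v y)"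
  shows "A = B"
  by (metis assms bilinear_entries vec_eq_iff)

lemma Vq_expand: "(Vq R *v a) $ q = expand R a (x_vol R q)"
  by (simp add: Vq_def expand_def matrix_vector_mult_def mult.commute)

lemma Vf_expand: "(Vf R *v a) $ s = expand R a (x_surf R s)"
  by (simp add: Vf_def expand_def matrix_vector_mult_def mult.commute)

text \<open>If \<open>A\<close> and \<open>B\<close> evaluate expansions at the points of a quadrature rule with weights \<open>w\<close>, this is
  the discrete $L^2$ inner product of the functions with coefficients \<open>a\<close> and \<open>b\<close>.\<close>

lemma weighted_inner:
  fixes A :: "real^'p^'q" and B :: "real^'r^'q"
  shows "a \<bullet> ((transpose A ** diagm w ** B) *v b) = (\<Sum>i\<in>UNIV. w $ i * ((A *v a) $ i * (B *v b) $ i))"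
proof -
  have *: "(diagm w *v z) $ i = w $ i * z $ i" for z i
    by (simp add: matrix_vector_mult_def diagm_def if_distrib[of "\<lambda>c. c * _"] sum.delta cong: if_cong)
  have "a \<bullet> ((transpose A ** diagm w ** B) *v b) = a \<bullet> (transpose A *v (diagm w *v (B *v b)))"
    by (simp only: matrix_vector_mul_assoc matrix_mul_assoc)
  also have "\<dots> = (A *v a) \<bullet> (diagm w *v (B *v b))"
    by (rule inner_transpose_mult_vec)
  finally show ?thesis
    by (simp add: inner_vec_def * ac_simps)
qed

text \<open>Every coefficient vector represents a polynomial of the approximation space, so this is the
  assumed integration by parts under quadrature, expressed in the basis.\<close>

lemma reference_integration_by_parts:
  assumes "approx_space R" "quadrature_rules R"
  shows "Mass R ** diff_matrix R i + transpose (diff_matrix R i) ** Mass R =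
    transpose (Vf R) ** Wf R ** diagm (nhat R i * Jhat R) ** Vf R"
proof (rule matrix_eq_bilinear)
  fix a b
  let ?u = "expand R a" and ?v = "expand R b"
  have p: "?u \<in> polys (deg R)" "?v \<in> polys (deg R)"
    using assms(1) by (auto simp: approx_space_def bij_betw_def)
  have d: "partial i (expand R c) = expand R (diff_matrix R i *v c)" for c
    using assms(1) by (simp add: approx_space_def)
  have ibp: "(\<Sum>q\<in>UNIV. w_vol R $ q * (partial i ?u (x_vol R q) * ?v (x_vol R q))) =
        (\<Sum>s\<in>UNIV. w_surf R $ s * Jhat R $ s * (?u (x_surf R s) * (?v (x_surf R s) * nhat R i $ s)))
        - (\<Sum>q\<in>UNIV. w_vol R $ q * (?u (x_vol R q) * partial i ?v (x_vol R q)))"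
    using assms(2) p unfolding quadrature_rules_def by blast
  have m: "x \<bullet> (Mass R *v y) =
      (\<Sum>q\<in>UNIV. w_vol R $ q * (expand R x (x_vol R q) * expand R y (x_vol R q)))" for x y
    by (simp add: Mass_def W_def weighted_inner Vq_expand)
  have "a \<bullet> ((Mass R ** diff_matrix R i + transpose (diff_matrix R i) ** Mass R) *v b) =
      a \<bullet> (Mass R *v (diff_matrix R i *v b)) + (diff_matrix R i *v a) \<bullet> (Mass R *v b)"
    by (simp only: matrix_vector_mult_add_rdistrib inner_add_right matrix_vector_mul_assoc[symmetric]
        inner_transpose_mult_vec)
  also have "\<dots> = (\<Sum>s\<in>UNIV. w_surf R $ s * Jhat R $ s * (?u (x_surf R s) * (?v (x_surf R s) * nhat R i $ s)))"
    using ibp by (simp add: m d)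
  also have "\<dots> = a \<bullet> ((transpose (Vf R) ** Wf R ** diagm (nhat R i * Jhat R) ** Vf R) *v b)"
    unfolding Wf_def matrix_mul_assoc[symmetric, of "transpose (Vf R)" "diagm _" "diagm _"]
      diagm_mult_diagm weighted_inner
    by (simp add: Vf_expand mult_ac)
  finally show "a \<bullet> ((Mass R ** diff_matrix R i + transpose (diff_matrix R i) ** Mass R) *v b) =
    a \<bullet> ((transpose (Vf R) ** Wf R ** diagm (nhat R i * Jhat R) ** Vf R) *v b)" .
qed

text \<open>The hybridized operator is built so that the boundary term of the integration by parts moves to
  the surface points.  Multiplication by the weights turns $W V_q$ into $P_q^T M$ and
  $W V_q L_q$ into $P_q^T V_f^T W_f$.  The volume block then has symmetric part
  $\frac12 P_q^T (M D + D^T M - V_f^T W_f B V_f) P_q = 0$, the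
  off-diagonal blocks are negative transposes of each other, and only the surface block
  $\frac12 W_f B$, which is diagonal, has a symmetric part.\<close>

lemma reference_summation_by_parts:
  assumes "reference_element R"
  shows "WN R ** DN R i + transpose (WN R ** DN R i) =
    diagm (vstack 0 (w_surf R * (nhat R i * Jhat R)))"
proof -
  define M V F P L D B where
    "M = Mass R" and "V = Vq R" and "F = Vf R" and "P = Pq R" and "L = Lq R"
    and "D = diff_matrix R i" and "B = diagm (nhat R i * Jhat R)"
  have inv: "invertible M"
    using assms unfolding reference_element_def M_def by (intro pos_def_imp_invertible) blast
  have symM: "transpose M = M"
    by (simp add: M_def Mass_symmetric)
  have MP: "M ** P = transpose V ** W R"
    using inv unfolding P_def Pq_def M_def V_def
    by (metis matrix_mul_assoc matrix_mul_lid invertible_mult_matrix_inv)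
  have WV: "W R ** V = transpose P ** M"
    using arg_cong[OF MP, of transpose] by (simp add: matrix_transpose_mul symM W_def)
  have WVL: "W R ** V ** L = transpose P ** transpose F ** Wf R"
  proof -
    have "W R ** V ** L = transpose P ** (M ** matrix_inv M) ** transpose F ** Wf R"
      by (simp add: WV L_def Lq_def F_def M_def matrix_mul_assoc)
    then show ?thesis
      using inv by (simp add: invertible_mult_matrix_inv)
  qed
  define K where "K = transpose F ** Wf R ** B ** F"
  have ibp: "M ** D + transpose D ** M = K"
    using reference_integration_by_parts[of R i] assms
    by (simp add: reference_element_def M_def D_def K_def F_def B_def)
  define S where "S = Wf R ** B"
  have S: "S = diagm (w_surf R * (nhat R i * Jhat R))"
    by (simp add: S_def B_def Wf_def diagm_mult_diagm)
  have symS: "transpose S = S"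
    by (simp add: S)
  have K: "K = transpose F ** S ** F"
    by (simp add: K_def S_def matrix_mul_assoc)
  have symK: "transpose K = K"
    by (simp add: K matrix_transpose_mul symS matrix_mul_assoc)
  define A11 where "A11 = transpose P ** M ** D ** P - (1/2) *\<^sub>R (transpose P ** K ** P)"
  define A12 where "A12 = (1/2) *\<^sub>R (transpose P ** transpose F ** S)"
  have eq: "WN R ** DN R i = block_matrix A11 A12 (- transpose A12) ((1/2) *\<^sub>R S)"
  proof -
    have "W R ** (V ** D ** P - (1/2) *\<^sub>R (V ** L ** B ** F ** P)) =
        (W R ** V) ** D ** P - (1/2) *\<^sub>R ((W R ** V ** L) ** B ** F ** P)"
      by (simp add: matrix_mult_scaleR matrix_mult_diff matrix_mul_assoc)
    then have 1: "W R ** (V ** D ** P - (1/2) *\<^sub>R (V ** L ** B ** F ** P)) = A11"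
      by (simp add: WVL A11_def K_def matrix_mul_assoc) (simp add: WV matrix_mul_assoc)
    have 2: "W R ** ((1/2) *\<^sub>R (V ** L ** B)) = A12"
      by (simp add: matrix_mult_scaleR matrix_mul_assoc WVL) (simp add: A12_def S_def matrix_mul_assoc)
    have 3: "Wf R ** (- (1/2) *\<^sub>R (B ** F ** P)) = - transpose A12"
      unfolding A12_def transpose_scalar matrix_transpose_mul symS
      by (simp only: matrix_mult_scaleR transpose_transpose S_def matrix_mul_assoc scaleR_minus_left[symmetric])
    have 4: "Wf R ** ((1/2) *\<^sub>R B) = (1/2) *\<^sub>R S"
      by (simp add: matrix_mult_scaleR S_def)
    show ?thesis
      unfolding WN_eq_diagm DN_def Let_def diagm_vstack_mult_block_matrix
      using 1 2 3 4 by (simp add: W_def Wf_def V_def F_def P_def L_def D_def B_def)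
  qed
  have A11: "A11 + transpose A11 = 0"
  proof -
    have "A11 + transpose A11 = transpose P ** (M ** D + transpose D ** M) ** P - transpose P ** K ** P"
      by (simp add: A11_def transpose_diff_minus transpose_scalar matrix_transpose_mul symK symM
          matrix_mul_assoc matrix_add_ldistrib matrix_add_mult)
    then show ?thesis by (simp add: ibp)
  qed
  show ?thesis
    unfolding eq transpose_block_matrix block_matrix_add A11
    by (simp add: vec_eq_iff all_sum_iff symS transpose_diff_minus transpose_scalar)
      (auto simp: S diagm_def)
qed


section \<open>Summation by parts on physical elements\<close>

text \<open>Averaging over left and right multiplication by the geometric terms gives the entries
  $\frac12\sum_j (G_m + G_l)(Q_N^j)_{ml}$.  The factor is symmetric in $m$ and $l$, so the
  symmetric part is still diagonal and carried by the surface points, where the assumption on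
  the geometric terms identifies it.\<close>

lemma Qk_summation_by_parts:
  assumes "reference_element R" "consistent_geometric_terms R \<T>"
  shows "Qk R \<T> k i + transpose (Qk R \<T> k i) =
    diagm (vstack 0 (w_surf R * (nvec R \<T> k i * Jfvec R \<T> k)))"
proof -
  define Q where "Q j = WN R ** DN R j" for j
  define G where "G = geo \<T> k i"
  have Qk: "Qk R \<T> k i $ m $ l = (1/2) * (\<Sum>j\<in>UNIV. (G j $ m + G j $ l) * Q j $ m $ l)" for m l
    by (simp add: Qk_def Dk_def WN_eq_diagm diagm_mult_row mult_diagm_nth Q_def G_def
        sum_distrib_left algebra_simps)
  have Q: "Q j $ m $ l + Q j $ l $ m =
      (if m = l then vstack 0 (w_surf R * (nhat R j * Jhat R)) $ m else 0)" for j m l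
    using arg_cong[OF reference_summation_by_parts[OF assms(1), of j], of "\<lambda>A. A $ m $ l"]
    by (simp add: Q_def transpose_def diagm_def)
  have "(Qk R \<T> k i + transpose (Qk R \<T> k i)) $ m $ l =
      (1/2) * (\<Sum>j\<in>UNIV. (G j $ m + G j $ l) * (Q j $ m $ l + Q j $ l $ m))" for m l
    by (simp add: transpose_def Qk sum.distrib[symmetric] algebra_simps)
  then have *: "(Qk R \<T> k i + transpose (Qk R \<T> k i)) $ m $ l =
      (if m = l then \<Sum>j\<in>UNIV. G j $ m * vstack 0 (w_surf R * (nhat R j * Jhat R)) $ m else 0)"
    for m l
    by (simp add: Q sum_distrib_left)
  have "(\<Sum>j\<in>UNIV. G j $ m * vstack 0 (w_surf R * (nhat R j * Jhat R)) $ m) =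
      vstack 0 (w_surf R * (nvec R \<T> k i * Jfvec R \<T> k)) $ m" for m
  proof (cases m)
    case (Inr s)
    have "(\<Sum>j\<in>UNIV. G j $ Inr s * (nhat R j $ s * Jhat R $ s)) = nvec R \<T> k i $ s * Jfvec R \<T> k $ s"
      using assms(2)[unfolded consistent_geometric_terms_def, rule_format, of k i, THEN arg_cong, of "\<lambda>x. x $ s"]
      by (simp add: G_def surf_part_def)
    moreover have "G j $ Inr s * (w_surf R $ s * (nhat R j $ s * Jhat R $ s)) =
        w_surf R $ s * (G j $ Inr s * (nhat R j $ s * Jhat R $ s))" for j
      by (rule mult.left_commute)
    ultimately show ?thesis
      unfolding Inr vstack_nth vector_mult_component by (simp only: sum_distrib_left[symmetric])
  qed simp
  then show ?thesis
    using * by (simp add: vec_eq_iff diagm_def)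
qed

section \<open>Flux differencing\<close>

text \<open>Let $e_{ml} = v_m \cdot F_{ml}$.  As $Q_{ml} = b_m\delta_{ml} - Q_{lm}$, one half of
  $2\sum Q_{ml} e_{ml}$ is transposed to give the diagonal terms plus
  $\sum Q_{ml}(e_{ml} - e_{lm})$, and by the symmetry of $F$ and the entropy condition the
  bracket is $\psi_m - \psi_l$.  Both potentials are summed separately: $\psi_m$ meets the row
  sums $Q 1 = 0$, and $\psi_l$ the column sums, which equal $b_l$.\<close>

lemma flux_differencing_balance:
  fixes Q :: "real^'m^'m" and v :: "real^'n^'m" and F :: "(real^'n)^'m^'m" and b \<psi> :: "real^'m"
  assumes sbp: "Q + transpose Q = diagm b" and cons: "Q *v 1 = 0"
    and sym: "\<And>m l. F $ m $ l = F $ l $ m"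
    and ec: "\<And>m l. (v $ m - v $ l) \<bullet> F $ m $ l = \<psi> $ m - \<psi> $ l"
  shows "v \<bullet> row_sums (had_mat (2 *\<^sub>R Q) F) = (\<Sum>m\<in>UNIV. b $ m * (v $ m \<bullet> F $ m $ m - \<psi> $ m))"
proof -
  have Q: "Q $ m $ l + Q $ l $ m = (if m = l then b $ m else 0)" for m l
    using arg_cong[OF sbp, of "\<lambda>A. A $ m $ l"] by (simp add: transpose_def diagm_def)
  have Qone: "(\<Sum>l\<in>UNIV. Q $ m $ l) = 0" for m
    using arg_cong[OF cons, of "\<lambda>x. x $ m"] by (simp add: matrix_vector_mult_def)
  define e where "e m l = v $ m \<bullet> F $ m $ l" for m l
  have ec': "e m l - e l m = \<psi> $ m - \<psi> $ l" for m l
    using ec[of m l] sym[of m l] by (simp add: e_def inner_diff_left)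
  have diag: "(\<Sum>m\<in>UNIV. \<Sum>l\<in>UNIV. (Q $ m $ l + Q $ l $ m) * h m l) = (\<Sum>m\<in>UNIV. b $ m * h m m)"
    for h :: "'m \<Rightarrow> 'm \<Rightarrow> real"
    by (simp add: Q if_distrib[of "\<lambda>c. c * _"] cong: if_cong)
  have swap: "(\<Sum>m\<in>UNIV. \<Sum>l\<in>UNIV. Q $ l $ m * h m l) = (\<Sum>m\<in>UNIV. \<Sum>l\<in>UNIV. Q $ m $ l * h l m)"
    for h :: "'m \<Rightarrow> 'm \<Rightarrow> real"
    by (rule sum.swap)
  have "v \<bullet> row_sums (had_mat (2 *\<^sub>R Q) F) = 2 * (\<Sum>m\<in>UNIV. \<Sum>l\<in>UNIV. Q $ m $ l * e m l)"
    by (simp add: inner_vec_def[of v] row_sums_def had_mat_def inner_sum_right e_def sum_distrib_left mult_ac)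
  also have "\<dots> = (\<Sum>m\<in>UNIV. b $ m * e m m) + (\<Sum>m\<in>UNIV. \<Sum>l\<in>UNIV. Q $ m $ l * (e m l - e l m))"
    using diag[of e] swap[of e] by (simp add: distrib_right sum.distrib right_diff_distrib sum_subtractf)
  also have "(\<Sum>m\<in>UNIV. \<Sum>l\<in>UNIV. Q $ m $ l * (e m l - e l m)) =
      (\<Sum>m\<in>UNIV. \<Sum>l\<in>UNIV. Q $ m $ l * \<psi> $ m) - (\<Sum>m\<in>UNIV. \<Sum>l\<in>UNIV. Q $ m $ l * \<psi> $ l)"
    by (simp add: ec' right_diff_distrib sum_subtractf)
  also have "(\<Sum>m\<in>UNIV. \<Sum>l\<in>UNIV. Q $ m $ l * \<psi> $ m) = 0"
    by (simp add: Qone flip: sum_distrib_right)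
  also have "(\<Sum>m\<in>UNIV. \<Sum>l\<in>UNIV. Q $ m $ l * \<psi> $ l) = (\<Sum>m\<in>UNIV. b $ m * \<psi> $ m)"
    using diag[of "\<lambda>m l. \<psi> $ m"] swap[of "\<lambda>m l. \<psi> $ m"]
    by (simp add: distrib_right sum.distrib Qone flip: sum_distrib_right)
  finally show ?thesis
    by (simp add: e_def right_diff_distrib sum_subtractf)
qed

section \<open>Rate of change of the entropy on an element\<close>

lemma Mk_eq: "Mk R \<T> k = transpose (Vq R) ** diagm (w_vol R * Jvec R \<T> k) ** Vq R"
  unfolding Mk_def W_def matrix_mul_assoc[symmetric, of "transpose (Vq R)" "diagm _" "diagm _"] diagm_mult_diagm ..

lemma Mk_symmetric: "transpose (Mk R \<T> k) = Mk R \<T> k"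
  by (simp add: Mk_eq matrix_transpose_mul matrix_mul_assoc)

text \<open>Positive definiteness is inherited from the reference mass matrix: since the weights and $J^k$
  are positive, both quadratic forms vanish exactly when all values at the volume points do.\<close>

lemma invertible_Mk:
  fixes R :: "('d::finite, 'e::finite, 'p::finite, 'q::finite, 'f::finite) ref_element"
  assumes "reference_element R" "decomposition R \<T>"
  shows "invertible (Mk R \<T> k)"
proof (rule pos_def_imp_invertible)
  fix a :: "real^'p"
  assume a: "a \<noteq> 0"
  have w: "w_vol R $ q > 0" and x: "x_vol R q \<in> elt R" for q
    using assms(1) by (auto simp: reference_element_def quadrature_rules_def)
  have J: "Jvec R \<T> k $ q > 0" for q
    using assms(2) x by (simp add: decomposition_def Jvec_def)
  have "0 < (\<Sum>q\<in>UNIV. w_vol R $ q * ((Vq R *v a) $ q * (Vq R *v a) $ q))"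
    using assms(1) a by (simp add: reference_element_def Mass_def W_def weighted_inner)
  then obtain q where q: "(Vq R *v a) $ q \<noteq> 0"
    by (metis (mono_tags, lifting) mult_zero_left mult_zero_right sum.neutral less_irrefl)
  show "a \<bullet> (Mk R \<T> k *v a) > 0"
    unfolding Mk_eq weighted_inner
  proof (rule sum_pos2[of _ q])
    show "0 < (w_vol R * Jvec R \<T> k) $ q * ((Vq R *v a) $ q * (Vq R *v a) $ q)"
      using w J q by (simp add: zero_less_mult_iff) (metis linorder_neqE)
  qed (use w J in \<open>auto intro!: mult_nonneg_nonneg simp: less_imp_le\<close>)
qed

lemma has_derivative_grad:
  assumes "h differentiable (at x)"
  shows "(h has_derivative (\<lambda>y. grad h x \<bullet> y)) (at x)"
proof -
  have d: "(h has_derivative frechet_derivative h (at x)) (at x)"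
    using assms by (simp add: frechet_derivative_works)
  then have lin: "linear (frechet_derivative h (at x))"
    by (rule has_derivative_linear)
  have "frechet_derivative h (at x) y = grad h x \<bullet> y" for y
  proof -
    have "frechet_derivative h (at x) y = frechet_derivative h (at x) (\<Sum>i\<in>UNIV. y $ i *\<^sub>R axis i 1)"
      using basis_expansion[of y] by (simp add: scalar_mult_eq_scaleR)
    then show ?thesis
      by (simp add: linear_sum[OF lin] linear_scale[OF lin] inner_vec_def grad_def partial_def mult.commute)
  qed
  then show ?thesis
    using d by (metis (no_types, lifting) ext)
qed

lemma deriv_entropy_along:
  assumes "entropy_system C" "c t \<in> states C" "(c has_vector_derivative c') (at t)"
  shows "deriv (\<lambda>\<tau>. entropy C (c \<tau>)) t = entropy_vars C (c t) \<bullet> c'"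
proof (rule DERIV_imp_deriv)
  have "Ck_on (Suc 0) (states C) (entropy C)"
    using assms(1) by (simp add: entropy_system_def smooth_on_def del: Ck_on.simps)
  then have "(entropy C has_derivative (\<lambda>y. entropy_vars C (c t) \<bullet> y)) (at (c t))"
    using assms(2) has_derivative_grad by (auto simp: entropy_vars_def)
  from has_derivative_compose[OF assms(3)[unfolded has_vector_derivative_def] this]
  show "((\<lambda>\<tau>. entropy C (c \<tau>)) has_real_derivative entropy_vars C (c t) \<bullet> c') (at t)"
    by (simp add: has_field_derivative_def mult_commute_abs)
qed

text \<open>The normal equations of the projection of the entropy variables.\<close>

lemma Mk_mult_v_proj:
  assumes "invertible (Mk R \<T> k)"
  shows "Mk R \<T> k ** v_proj C R \<T> k c =
    transpose (Vq R) ** (diagm (w_vol R * Jvec R \<T> k) ** vec_map (entropy_vars C) (u_quad R c))"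
  by (simp add: v_proj_def Pqk_def W_def matrix_mul_assoc invertible_mult_matrix_inv[OF assms])
     (simp add: matrix_mul_assoc[symmetric] diagm_mult_diagm)

text \<open>The rate $du_q/dt = V_q\, du_h/dt$ is a polynomial evaluated at the volume points, hence the
  weighted inner product with $v(u_q)$ does not change when $v(u_q)$ is replaced by its projection.\<close>

lemma entropy_rate_eq_projected_rate:
  fixes c :: "real \<Rightarrow> real^'n^'p"
  assumes "entropy_system C" "invertible (Mk R \<T> k)"
    and "\<And>i. u_quad R (c t) $ i \<in> states C"
    and der: "(c has_vector_derivative c') (at t)"
  shows "1 \<bullet> ((diagm (Jvec R \<T> k) ** W R) *v (\<chi> i. deriv (\<lambda>\<tau>. entropy C (u_quad R (c \<tau>) $ i)) t)) =
    v_proj C R \<T> k (c t) \<bullet> (Mk R \<T> k ** c')"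
proof -
  define v where "v = vec_map (entropy_vars C) (u_quad R (c t))"
  have "((\<lambda>\<tau>. u_quad R (c \<tau>) $ i) has_vector_derivative u_quad R c' $ i) (at t)" for i
    unfolding u_quad_def matrix_mult_row
    by (intro has_vector_derivative_sum bounded_linear.has_vector_derivative[OF _ der]
        bounded_linear_scaleR_right bounded_linear_compose[OF bounded_linear_scaleR_right]
        bounded_linear_vec_nth)
  then have "deriv (\<lambda>\<tau>. entropy C (u_quad R (c \<tau>) $ i)) t = v $ i \<bullet> u_quad R c' $ i" for i
    using deriv_entropy_along[OF assms(1), where c = "\<lambda>\<tau>. u_quad R (c \<tau>) $ i"] assms(3)
    by (simp add: v_def vec_map_def)
  then have "1 \<bullet> ((diagm (Jvec R \<T> k) ** W R) *v (\<chi> i. deriv (\<lambda>\<tau>. entropy C (u_quad R (c \<tau>) $ i)) t)) =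
      (Vq R ** c') \<bullet> (diagm (w_vol R * Jvec R \<T> k) ** v)"
    unfolding W_def diagm_mult_diagm one_inner_diagm
    by (simp add: inner_vec_def[of "Vq R ** c'"] diagm_mult_row u_quad_def inner_commute mult_ac)
  also have "\<dots> = c' \<bullet> (Mk R \<T> k ** v_proj C R \<T> k (c t))"
    by (simp only: inner_matrix_mult Mk_mult_v_proj[OF assms(2)] v_def)
  also have "\<dots> = v_proj C R \<T> k (c t) \<bullet> (Mk R \<T> k ** c')"
    using inner_matrix_mult[of "Mk R \<T> k" "v_proj C R \<T> k (c t)" c'] by (simp add: Mk_symmetric inner_commute)
  finally show ?thesis .
qed

section \<open>Entropy balance of the scheme on an element\<close>

text \<open>The lifting of the volume term in the scheme is the adjoint of evaluation at all quadrature
  points, so that testing with $v_h$ produces $\tilde v$ and turns $D_k^j$ into $Q_k^j$.\<close>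

lemma hstack_eq_transpose_vstack:
  "hstack (transpose (Vq R) ** W R) (transpose (Vf R) ** Wf R) = transpose (vstack (Vq R) (Vf R)) ** WN R"
  by (simp add: vec_eq_iff all_sum_iff WN_eq_diagm W_def Wf_def mult_diagm_nth hstack_def transpose_def)

lemma diagm_row_sums_had_mat: "diagm w ** row_sums (had_mat A F) = row_sums (had_mat (diagm w ** A) F)"
  by (simp add: vec_eq_iff diagm_mult_row row_sums_def had_mat_def sum_distrib_left mult.assoc)

lemma matrix_mult_sum:
  fixes A :: "real^'b^'a" and X :: "'j \<Rightarrow> real^'c^'b"
  shows "A ** (\<Sum>j\<in>S. X j) = (\<Sum>j\<in>S. A ** X j)"
  by (induction S rule: infinite_finite_induct) (simp_all add: matrix_add_ldistrib)

lemma Mk_mult_scheme_terms: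
  fixes C :: "('d::finite, 'n::finite) conservation_law"
    and R :: "('d, 'e, 'p::finite, 'q::finite, 'f::finite) ref_element"
  assumes "invertible (Mk R \<T> k)"
  shows "Mk R \<T> k ** scheme_terms C R \<T> fS g cs k =
    (\<Sum>j\<in>UNIV. transpose (vstack (Vq R) (Vf R)) **
        row_sums (had_mat (2 *\<^sub>R Qk R \<T> k j) (flux_matrix (fS j) (u_tilde C R \<T> k (cs k)))))
    + (\<Sum>j\<in>UNIV. transpose (Vf R) ** (diagm (w_surf R * (nvec R \<T> k j * Jfvec R \<T> k)) **
          (flux_star C R \<T> fS g cs k j - vec_map (flux C j) (surf_part (u_tilde C R \<T> k (cs k))))))"
proof -
  have 1: "Mk R \<T> k ** (matrix_inv (Mk R \<T> k) ** X) = X" for X :: "real^'n^'p"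
    by (simp add: matrix_mul_assoc invertible_mult_matrix_inv[OF assms])
  have 2: "transpose Z ** WN R ** row_sums (had_mat (2 *\<^sub>R Dk R \<T> k j) F) =
      transpose Z ** row_sums (had_mat (2 *\<^sub>R Qk R \<T> k j) F)"
    for j and F :: "(real^'n)^('q + 'f)^('q + 'f)" and Z :: "real^'p^('q + 'f)"
    by (simp add: Qk_def WN_eq_diagm matrix_mul_assoc[symmetric] diagm_row_sums_had_mat matrix_mult_scaleR)
  have 3: "Lqk R \<T> k ** diagm (nvec R \<T> k j) ** X = matrix_inv (Mk R \<T> k) **
      (transpose (Vf R) ** (diagm (w_surf R * (nvec R \<T> k j * Jfvec R \<T> k)) ** X))"
    for j and X :: "real^'n^'f"
  proof -
    have "diagm (w_surf R * (nvec R \<T> k j * Jfvec R \<T> k)) =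
        Wf R ** diagm (Jfvec R \<T> k) ** diagm (nvec R \<T> k j)"
      by (simp add: Wf_def diagm_mult_diagm mult_ac)
    then show ?thesis
      by (simp add: Lqk_def matrix_mul_assoc)
  qed
  show ?thesis
    unfolding scheme_terms_def hstack_eq_transpose_vstack matrix_add_ldistrib matrix_mult_sum 3 1
    unfolding matrix_mul_assoc[symmetric, of "matrix_inv _"] 1 2 ..
qed

lemma state_of_in_states:
  assumes "v \<in> entropy_vars C ` states C"
  shows "state_of C v \<in> states C" "entropy_vars C (state_of C v) = v"
  using assms by (simp_all add: state_of_def inv_into_into f_inv_into_f)

text \<open>The volume term yields $\tilde v_f \cdot f_j(\tilde u_f) - \psi_j$ at the surface points and the
  surface correction yields $\tilde v_f \cdot (f_j^* - f_j(\tilde u_f))$, so the value of the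
  physical flux drops out.  The states at which the fluxes are evaluated have entropy variables
  exactly $\tilde v$, which is what makes the entropy condition applicable with
  the test function $\tilde v$.\<close>

lemma element_entropy_balance:
  assumes "reference_element R" "admissible_mesh R \<T>"
    and fS: "\<And>i. entropy_conservative_flux C i (fS i)"
    and cons: "\<And>j. Qk R \<T> k j *v 1 = 0"
    and st: "\<And>m. v_tilde C R \<T> k (cs k) $ m \<in> entropy_vars C ` states C"
  shows "v_proj C R \<T> k (cs k) \<bullet> (Mk R \<T> k ** scheme_terms C R \<T> fS g cs k) =
    - (\<Sum>j\<in>UNIV. \<Sum>s\<in>UNIV. w_surf R $ s * (nvec R \<T> k j $ s * Jfvec R \<T> k $ s) *
        (potential C j (v_tilde C R \<T> k (cs k) $ Inr s)
          - v_tilde C R \<T> k (cs k) $ Inr s \<bullet> flux_star C R \<T> fS g cs k j $ s))"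
proof -
  define v where "v = v_tilde C R \<T> k (cs k)"
  define u where "u = u_tilde C R \<T> k (cs k)"
  define b where "b j = w_surf R * (nvec R \<T> k j * Jfvec R \<T> k)" for j
  define f where "f j = flux_star C R \<T> fS g cs k j" for j
  have u: "u $ m \<in> states C" "entropy_vars C (u $ m) = v $ m" for m
    using state_of_in_states[OF st] by (simp_all add: u_def v_def u_tilde_def vec_map_def)
  have inv: "invertible (Mk R \<T> k)"
    using assms(1,2) by (simp add: invertible_Mk admissible_mesh_def)
  have vol: "v \<bullet> row_sums (had_mat (2 *\<^sub>R Qk R \<T> k j) (flux_matrix (fS j) u)) =
      (\<Sum>s\<in>UNIV. b j $ s * (v $ Inr s \<bullet> flux C j (u $ Inr s) - potential C j (v $ Inr s)))" for j
  proof -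
    have "Qk R \<T> k j + transpose (Qk R \<T> k j) = diagm (vstack 0 (b j))"
      unfolding b_def using assms(1,2) by (intro Qk_summation_by_parts) (simp_all add: admissible_mesh_def)
    moreover have "fS j (u $ m) (u $ l) = fS j (u $ l) (u $ m)"
        "(v $ m - v $ l) \<bullet> fS j (u $ m) (u $ l) = potential C j (v $ m) - potential C j (v $ l)"
      for m l
      using fS[of j] u(1) unfolding entropy_conservative_flux_def u(2)[symmetric] by blast+
    ultimately have "v \<bullet> row_sums (had_mat (2 *\<^sub>R Qk R \<T> k j) (flux_matrix (fS j) u)) =
      (\<Sum>m\<in>UNIV. vstack 0 (b j) $ m * (v $ m \<bullet> flux_matrix (fS j) u $ m $ m - (\<chi> m. potential C j (v $ m)) $ m))"
      by (intro flux_differencing_balance[OF _ cons]) (simp_all add: flux_matrix_def)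
    moreover have "fS j (u $ m) (u $ m) = flux C j (u $ m)" for m
      using fS[of j] u(1) unfolding entropy_conservative_flux_def by blast
    ultimately show ?thesis
      by (simp add: sum_UNIV_Plus flux_matrix_def)
  qed
  have surf: "(Vf R ** v_proj C R \<T> k (cs k)) $ s = v $ Inr s" for s
    by (simp add: v_def v_tilde_def matrix_mult_row)
  have "v_proj C R \<T> k (cs k) \<bullet> (Mk R \<T> k ** scheme_terms C R \<T> fS g cs k) =
      (\<Sum>j\<in>UNIV. v \<bullet> row_sums (had_mat (2 *\<^sub>R Qk R \<T> k j) (flux_matrix (fS j) u)))
    + (\<Sum>j\<in>UNIV. (Vf R ** v_proj C R \<T> k (cs k)) \<bullet> (diagm (b j) ** (f j - vec_map (flux C j) (surf_part u))))"
    unfolding Mk_mult_scheme_terms[OF inv] inner_add_right inner_sum_right inner_matrix_mult[symmetric]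
    by (simp add: v_def v_tilde_def u_def b_def f_def)
  also have "\<dots> = (\<Sum>j\<in>UNIV. \<Sum>s\<in>UNIV. b j $ s * (v $ Inr s \<bullet> flux C j (u $ Inr s) - potential C j (v $ Inr s)))
     + (\<Sum>j\<in>UNIV. \<Sum>s\<in>UNIV. b j $ s * (v $ Inr s \<bullet> f j $ s - v $ Inr s \<bullet> flux C j (u $ Inr s)))"
    by (simp add: vol inner_vec_def[of "Vf R ** _"] surf diagm_mult_row vec_map_def surf_part_def inner_diff_right)
  also have "\<dots> = - (\<Sum>j\<in>UNIV. \<Sum>s\<in>UNIV. b j $ s * (potential C j (v $ Inr s) - v $ Inr s \<bullet> f j $ s))"
    by (simp add: sum.distrib[symmetric] sum_negf[symmetric] algebra_simps)
  finally show ?thesis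
    by (simp add: v_def b_def f_def)
qed

section \<open>Cancellation at interfaces\<close>

lemma sum_antisymmetric_involution:
  fixes h :: "'a \<Rightarrow> real"
  assumes "\<And>x. x \<in> A \<Longrightarrow> \<sigma> x \<in> A" "\<And>x. x \<in> A \<Longrightarrow> \<sigma> (\<sigma> x) = x" "\<And>x. x \<in> A \<Longrightarrow> h (\<sigma> x) = - h x"
  shows "sum h A = 0"
proof -
  have "sum h A = (\<Sum>x\<in>A. h (\<sigma> x))"
    by (rule sum.reindex_bij_witness[of _ \<sigma> \<sigma>]) (use assms in auto)
  also have "\<dots> = - sum h A"
    using assms(3) by (simp add: sum_negf)
  finally show ?thesis by simp
qed

lemma boundary_face_imp_frontier:
  assumes "quadrature_rules R" "boundary_face R \<T> k (surf_face R s)"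
  shows "phys_point R \<T> k s \<in> frontier (domain \<T>)"
  using assms unfolding quadrature_rules_def boundary_face_def phys_face_def phys_point_def face_def x_surf_def
  by blast

text \<open>The matching of surface points is an involution on the points off $\partial\Omega$, because matched
  points have the same physical location.  It reverses the sign of $n J_f$ and preserves
  $\psi_j - \tilde v_f \cdot f_j^*$.\<close>

lemma interface_contributions_cancel:
  assumes "quadrature_rules R" "watertight R \<T>" "matching_quadrature R \<T>"
    and fS: "entropy_conservative_flux C j (fS j)"
    and st: "\<And>k m. v_tilde C R \<T> k (cs k) $ m \<in> entropy_vars C ` states C"
  shows "(\<Sum>(k, s) | phys_point R \<T> k s \<notin> frontier (domain \<T>).
      w_surf R $ s * (nvec R \<T> k j $ s * Jfvec R \<T> k $ s) *
        (potential C j (v_tilde C R \<T> k (cs k) $ Inr s)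
          - v_tilde C R \<T> k (cs k) $ Inr s \<bullet> flux_star C R \<T> fS g cs k j $ s)) = 0"
    (is "sum (\<lambda>(k, s). ?h k s) ?A = 0")
proof (rule sum_antisymmetric_involution[where \<sigma> = "nbr_point \<T>"])
  fix x assume "x \<in> ?A"
  then obtain k s where x: "x = (k, s)" and int: "phys_point R \<T> k s \<notin> frontier (domain \<T>)"
    by auto
  obtain k' s' where x': "nbr_point \<T> (k, s) = (k', s')"
    by fastforce
  have nb: "\<not> boundary_face R \<T> k (surf_face R s)"
    using int boundary_face_imp_frontier[OF assms(1)] by metis
  with assms(3) x' have match: "nbr_face \<T> (k, surf_face R s) = (k', surf_face R s')"
      "nbr_point \<T> (k', s') = (k, s)" "phys_point R \<T> k' s' = phys_point R \<T> k s"
      "w_surf R $ s' = w_surf R $ s"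
      "\<And>i. nvec R \<T> k i $ s * Jfvec R \<T> k $ s = - (nvec R \<T> k' i $ s' * Jfvec R \<T> k' $ s')"
    unfolding matching_quadrature_def by blast+
  show "nbr_point \<T> x \<in> ?A" "nbr_point \<T> (nbr_point \<T> x) = x"
    using int by (simp_all add: x x' match)
  \<comment> \<open>Both sides must use the interior formula of the numerical flux.  Adjacent faces are the same
    subset of space, so neither of them lies in the boundary of the domain.\<close>
  have nb': "\<not> boundary_face R \<T> k' (surf_face R s')"
    using assms(2) nb match(1) by (metis watertight_def boundary_face_def)
  define u where "u k m = u_tilde C R \<T> k (cs k) $ m" for k m
  define v where "v k m = v_tilde C R \<T> k (cs k) $ m" for k m
  have u: "u k m \<in> states C" "entropy_vars C (u k m) = v k m" for k m
    using state_of_in_states[OF st] by (simp_all add: u_def v_def u_tilde_def vec_map_def)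
  define F where "F = fS j (u k' (Inr s')) (u k (Inr s))"
  have F: "flux_star C R \<T> fS g cs k j $ s = F" "flux_star C R \<T> fS g cs k' j $ s' = F"
    using nb nb' x' match(2) fS u(1)
    by (auto simp: flux_star_def F_def u_def[symmetric] entropy_conservative_flux_def)
  have "(v k' (Inr s') - v k (Inr s)) \<bullet> F = potential C j (v k' (Inr s')) - potential C j (v k (Inr s))"
    using fS u unfolding entropy_conservative_flux_def F_def by metis
  then have "potential C j (v k' (Inr s')) - v k' (Inr s') \<bullet> F = potential C j (v k (Inr s)) - v k (Inr s) \<bullet> F"
    by (simp add: inner_diff_left)
  then have "?h k' s' = - ?h k s"
    using match(4) match(5)[of j] by (simp add: F v_def)
  then show "(\<lambda>(k, s). ?h k s) (nbr_point \<T> x) = - (\<lambda>(k, s). ?h k s) x"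
    by (simp add: x x')
qed

section \<open>Global entropy balance\<close>

theorem theorem1:
  fixes C :: "('d::finite, 'n::finite) conservation_law"
    and R :: "('d, 'e::finite, 'p::finite, 'q::finite, 'f::finite) ref_element"
    and \<T> :: "('d, 'k::finite, 'e, 'q, 'f) mesh"
    and fS :: "'d \<Rightarrow> real^'n \<Rightarrow> real^'n \<Rightarrow> real^'n"
    and g :: "real \<Rightarrow> 'd \<Rightarrow> 'k \<Rightarrow> 'f \<Rightarrow> real^'n"
    and uh :: "'k \<Rightarrow> real \<Rightarrow> real^'n^'p"
    and T :: "real set" and t \<rho> :: real
  assumes "entropy_system C"
    and "reference_element R"
    and "admissible_mesh R \<T>"
    and "quasi_uniform \<rho> R \<T>"
    and "\<And>i. entropy_conservative_flux C i (fS i)"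
    and "\<And>k j. Qk R \<T> k j *v 1 = 0"
    and "open T" and "t \<in> T"
    and "admissible_states C R \<T> T uh"
    and "solves_scheme C R \<T> fS g T uh"
  shows "(\<Sum>k\<in>UNIV. 1 \<bullet> ((diagm (Jvec R \<T> k) ** W R) *v
            (\<chi> i. deriv (\<lambda>\<tau>. entropy C (u_quad R (uh k \<tau>) $ i)) t))) =
         (\<Sum>k\<in>UNIV. \<Sum>j\<in>UNIV. 1 \<bullet> ((diagm (nvec R \<T> k j * Jfvec R \<T> k) ** W_boundary R \<T> k) *v
            (\<chi> s. potential C j (entropy_vars C (surf_part (u_tilde C R \<T> k (uh k t)) $ s))
                 - surf_part (v_tilde C R \<T> k (uh k t)) $ s
                     \<bullet> flux_star C R \<T> fS (g t) (\<lambda>l. uh l t) k j $ s)))"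
proof -
  define cs where "cs = (\<lambda>l. uh l t)"
  define v where "v k s = v_tilde C R \<T> k (cs k) $ Inr s" for k s
  define h where "h j k s = w_surf R $ s * (nvec R \<T> k j $ s * Jfvec R \<T> k $ s) *
      (potential C j (v k s) - v k s \<bullet> flux_star C R \<T> fS (g t) cs k j $ s)" for j k s
  let ?\<Gamma> = "\<lambda>k s. phys_point R \<T> k s \<in> frontier (domain \<T>)"
  have stq: "u_quad R (uh k t) $ i \<in> states C" and stv: "v_tilde C R \<T> k (cs k) $ m \<in> entropy_vars C ` states C" for k i m
    using assms(8,9) by (simp_all add: admissible_states_def cs_def)
  have rate: "1 \<bullet> ((diagm (Jvec R \<T> k) ** W R) *v
            (\<chi> i. deriv (\<lambda>\<tau>. entropy C (u_quad R (uh k \<tau>) $ i)) t)) = (\<Sum>j\<in>UNIV. \<Sum>s\<in>UNIV. h j k s)" for k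
  proof -
    obtain u' where u': "(uh k has_vector_derivative u') (at t)"
        and "u' + scheme_terms C R \<T> fS (g t) cs k = 0"
      using assms(8,10) unfolding solves_scheme_def cs_def by blast
    then have eq: "u' = (-1) *\<^sub>R scheme_terms C R \<T> fS (g t) cs k"
      by (simp add: eq_neg_iff_add_eq_0)
    have "invertible (Mk R \<T> k)"
      using assms(2,3) by (simp add: invertible_Mk admissible_mesh_def)
    from entropy_rate_eq_projected_rate[OF assms(1) this stq u']
    show ?thesis
      using element_entropy_balance[where cs = cs and g = "g t", OF assms(2,3,5,6) stv]
      unfolding eq matrix_mult_scaleR
      by (simp add: h_def v_def cs_def)
  qed
  \<comment> \<open>A point of an interior face may lie on the boundary of the domain, for example at a vertex.
    The split is therefore by location, as in \<open>W_boundary\<close>; every point elsewhere belongs to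
    an interior face and is covered by the interface cancellation.\<close>
  have int: "(\<Sum>k\<in>UNIV. \<Sum>s\<in>UNIV. h j k s) = (\<Sum>k\<in>UNIV. \<Sum>s\<in>UNIV. if ?\<Gamma> k s then h j k s else 0)" for j
  proof -
    have "(\<Sum>(k, s) | \<not> ?\<Gamma> k s. h j k s) = 0"
      unfolding h_def v_def
      by (rule interface_contributions_cancel)
         (use assms(2,3,5) stv in \<open>simp_all add: reference_element_def admissible_mesh_def\<close>)
    also have "(\<Sum>(k, s) | \<not> ?\<Gamma> k s. h j k s) = (\<Sum>(k, s)\<in>UNIV. if ?\<Gamma> k s then 0 else h j k s)"
      by (rule sum.mono_neutral_cong_left) auto
    finally have "(\<Sum>k\<in>UNIV. \<Sum>s\<in>UNIV. if ?\<Gamma> k s then 0 else h j k s) = 0"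
      by (simp add: sum.cartesian_product)
    then have "(\<Sum>k\<in>UNIV. \<Sum>s\<in>UNIV. if ?\<Gamma> k s then h j k s else 0) =
        (\<Sum>k\<in>UNIV. \<Sum>s\<in>UNIV. (if ?\<Gamma> k s then h j k s else 0) + (if ?\<Gamma> k s then 0 else h j k s))"
      by (simp only: sum.distrib add_0_right)
    also have "\<dots> = (\<Sum>k\<in>UNIV. \<Sum>s\<in>UNIV. h j k s)"
      by (intro sum.cong) simp_all
    finally show ?thesis ..
  qed
  have bdry: "1 \<bullet> ((diagm (nvec R \<T> k j * Jfvec R \<T> k) ** W_boundary R \<T> k) *v
            (\<chi> s. potential C j (entropy_vars C (surf_part (u_tilde C R \<T> k (uh k t)) $ s))
                 - surf_part (v_tilde C R \<T> k (uh k t)) $ s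
                     \<bullet> flux_star C R \<T> fS (g t) (\<lambda>l. uh l t) k j $ s)) =
      (\<Sum>s\<in>UNIV. if ?\<Gamma> k s then h j k s else 0)" for k j
    unfolding W_boundary_def diagm_mult_diagm one_inner_diagm
    using state_of_in_states(2)[OF stv]
    by (intro sum.cong refl) (simp add: h_def v_def cs_def surf_part_def u_tilde_def vec_map_def)
  have "(\<Sum>k\<in>UNIV. \<Sum>j\<in>UNIV. \<Sum>s\<in>UNIV. h j k s) = (\<Sum>j\<in>UNIV. \<Sum>k\<in>UNIV. \<Sum>s\<in>UNIV. h j k s)"
    by (rule sum.swap)
  also have "\<dots> = (\<Sum>j\<in>UNIV. \<Sum>k\<in>UNIV. \<Sum>s\<in>UNIV. if ?\<Gamma> k s then h j k s else 0)"
    by (simp only: int)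
  also have "\<dots> = (\<Sum>k\<in>UNIV. \<Sum>j\<in>UNIV. \<Sum>s\<in>UNIV. if ?\<Gamma> k s then h j k s else 0)"
    by (rule sum.swap)
  finally show ?thesis
    unfolding rate bdry .
qed

end
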